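(* Let $c>0$, $t>0$ and $n\ge 1$ an integer, and let $\underline{\mathbf X}_d(t)$ and $\underline{\mathbf Y}_d(t)$ be the positions at time $t$ of the $d$-dimensional random flights with $n$ changes of direction defined in the context. (i) For every integer $d\ge2$, the probability law of $\underline{\mathbf X}_d(t)$ has density $$p_{\underline{\mathbf X}_d}(\underline{\mathbf x}_d,t;n)=\frac{\Gamma\left(\frac{n+1}{2}(d-1)+\frac12\right)}{\Gamma\left(\frac{n}{2}(d-1)\right)}\frac{(c^2t^2-\|\underline{\mathbf x}_d\|^2)^{\frac{n}{2}(d-1)-1}}{\pi^{d/2}(ct)^{(n+1)(d-1)-1}},\qquad \|\underline{\mathbf x}_d\|<ct,$$ with respect to Lebesgue measure on $\mathbb{R}^d$ (and zero for $\|\underline{\mathbf x}_d\|\ge ct$). (ii) For every integer $d\ge3$, the probability law of $\underline{\mathbf Y}_d(t)$ has density $$p_{\underline{\mathbf Y}_d}(\underline{\mathbf y}_d,t;n)=\frac{\Gamma\left((n+1)(\frac d2-1)+1\right)}{\Gamma\left(n(\frac d2-1)\right)}\frac{(c^2t^2-\|\underline{\mathbf y}_d\|^2)^{n(\frac d2-1)-1}}{\pi^{d/2}(ct)^{2(n+1)(\frac d2-1)}},\qquad \|\underline{\mathbf y}_d\|<ct,$$ with respect to Lebesgue measure on $\mathbb{R}^d$ (and zero for $\|\underline{\mathbf y}_d\|\ge ct$).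
   Context: $\|\cdot\|$ is the Euclidean norm on $\mathbb{R}^d$. Random flights with a fixed number $n\ge1$ of changes of direction. Fix $c>0$ (speed), $t>0$. Let $V_1,\dots,V_{n+1}$ be independent random vectors uniformly distributed on the unit sphere of $\mathbb{R}^d$ (in hyperspherical coordinates $(\theta_1,\dots,\theta_{d-2},\phi)\in[0,\pi]^{d-2}\times[0,2\pi]$ each has joint density $\frac{\Gamma(d/2)}{2\pi^{d/2}}\sin^{d-2}\theta_1\sin^{d-3}\theta_2\cdots\sin\theta_{d-2}$). Let $(\tau_1,\dots,\tau_n)$ be a random vector independent of the $V_j$'s, with $\tau_j>0$, $\sum_{j=1}^n\tau_j<t$, and put $\tau_{n+1}=t-\sum_{j=1}^n\tau_j$. The position at time $t$ is $c\sum_{j=1}^{n+1}\tau_jV_j$. For $d\ge2$, $\underline{\mathbf X}_d(t)=(X_1(t),\dots,X_d(t))$ denotes this position when $(\tau_1,\dots,\tau_n)$ has the rescaled Dirichlet density $$f_1(\tau_1,\dots,\tau_n)=\frac{\Gamma((n+1)(d-1))}{(\Gamma(d-1))^{n+1}}\frac{1}{t^{(n+1)(d-1)-1}}\prod_{j=1}^{n+1}\tau_j^{d-2}$$ on $\{\tau_j>0,\ \sum_{j=1}^n\tau_j<t\}$. For $d\ge3$, $\underline{\mathbf Y}_d(t)=(Y_1(t),\dots,Y_d(t))$ denotes this position when $(\tau_1,\dots,\tau_n)$ has the rescaled Dirichlet density $$f_2(\tau_1,\dots,\tau_n)=\frac{\Gamma((n+1)(\frac d2-1))}{(\Gamma(\frac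 d2-1))^{n+1}}\frac{1}{t^{(n+1)(\frac d2-1)-1}}\prod_{j=1}^{n+1}\tau_j^{\frac d2-2}$$ on the same set. *)

theory Defs
  imports "HOL-Probability.Probability"
begin

text \<open>Hyperspherical coordinates on the unit sphere of a \<open>d\<close>-dimensional space, \<open>d \<ge> 2\<close>.
  The angles are numbered from 0: \<open>\<theta> 0, \<dots>, \<theta> (d - 3)\<close> are the polar angles
  \<open>\<theta>\<^sub>1, \<dots>, \<theta>\<^sub>d\<^sub>-\<^sub>2\<close> and \<open>\<theta> (d - 2)\<close> is the azimuth \<open>\<phi>\<close>.
  Coordinate \<open>k < d - 1\<close> is \<open>sin (\<theta> 0) \<dots> sin (\<theta> (k - 1)) cos (\<theta> k)\<close>, and the
  last one is the product of all the sines.\<close>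

definition hyperspherical_coord :: "nat \<Rightarrow> (nat \<Rightarrow> real) \<Rightarrow> nat \<Rightarrow> real" where
  "hyperspherical_coord d \<theta> k =
     (\<Prod>i<k. sin (\<theta> i)) * (if k < d - 1 then cos (\<theta> k) else 1)"

text \<open>The index type carries no order, so its elements are numbered by \<^const>\<open>to_nat_on\<close>, which
  is a bijection onto \<open>{..<CARD('d)}\<close>. The uniform law is permutation invariant, so the choice of
  numbering is immaterial.\<close>

definition hyperspherical :: "(nat \<Rightarrow> real) \<Rightarrow> real ^ 'd" where
  "hyperspherical \<theta> =
     (\<chi> i. hyperspherical_coord CARD('d) \<theta> (to_nat_on (UNIV :: 'd set) i))"

definition hyperspherical_density :: "nat \<Rightarrow> (nat \<Rightarrow> real) \<Rightarrow> real" where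
  "hyperspherical_density d \<theta> =
     (if (\<forall>i<d - 2. 0 \<le> \<theta> i \<and> \<theta> i \<le> pi) \<and> 0 \<le> \<theta> (d - 2) \<and> \<theta> (d - 2) \<le> 2 * pi
      then Gamma (real d / 2) / (2 * pi powr (real d / 2)) * (\<Prod>i<d - 2. sin (\<theta> i) ^ (d - 2 - i))
      else 0)"

definition uniform_sphere :: "(real ^ 'd) measure" where
  "uniform_sphere =
     distr (density (PiM {..<CARD('d) - 1} (\<lambda>_. lborel))
              (\<lambda>\<theta>. ennreal (hyperspherical_density CARD('d) \<theta>)))
       borel hyperspherical"

text \<open>The duration of the \<open>j\<close>-th displacement, given the first \<open>n\<close> durations.\<close>

definition duration :: "real \<Rightarrow> nat \<Rightarrow> (nat \<Rightarrow> real) \<Rightarrow> nat \<Rightarrow> real" where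
  "duration t n s j = (if j = n + 1 then t - (\<Sum>i=1..n. s i) else s j)"

text \<open>The density, with respect to Lebesgue measure on \<open>\<real>\<^sup>n\<close>, of the first \<open>n\<close> components of
  \<open>t\<close> times a Dirichlet vector with all \<open>n + 1\<close> parameters equal to \<open>a\<close>.\<close>

definition rescaled_dirichlet_density :: "real \<Rightarrow> real \<Rightarrow> nat \<Rightarrow> (nat \<Rightarrow> real) \<Rightarrow> real" where
  "rescaled_dirichlet_density a t n s =
     (if (\<forall>j\<in>{1..n}. 0 < s j) \<and> (\<Sum>j=1..n. s j) < t
      then Gamma (real (n + 1) * a) / Gamma a ^ (n + 1)
             * (1 / t powr (real (n + 1) * a - 1))
             * (\<Prod>j=1..n + 1. duration t n s j powr (a - 1))
      else 0)"

text \<open>The library's \<^const>\<open>prob_space.indep_var\<close> only relates variables with values in the same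
  type, so independence of the durations from the directions is stated for the generated
  \<open>\<sigma>\<close>-algebras.\<close>

locale random_flight = prob_space M
  for M :: "'w measure" and t :: real and n :: nat
    and \<tau> :: "nat \<Rightarrow> 'w \<Rightarrow> real" and V :: "nat \<Rightarrow> 'w \<Rightarrow> real ^ 'd" +
  assumes indep_directions: "indep_vars (\<lambda>_. borel) V {1..n + 1}"
    and uniform_directions: "\<And>j. j \<in> {1..n + 1} \<Longrightarrow> distr M borel (V j) = uniform_sphere"
    and indep_durations:
      "indep_set
         (sets (vimage_algebra (space M) (\<lambda>\<omega>. \<lambda>j\<in>{1..n}. \<tau> j \<omega>) (PiM {1..n} (\<lambda>_. borel))))
         (sets (vimage_algebra (space M) (\<lambda>\<omega>. \<lambda>j\<in>{1..n + 1}. V j \<omega>) (PiM {1..n + 1} (\<lambda>_. borel))))"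
    and durations_simplex:
      "AE \<omega> in M. (\<forall>j\<in>{1..n}. 0 < \<tau> j \<omega>) \<and> (\<Sum>j=1..n. \<tau> j \<omega>) < t"

definition flight_position ::
  "real \<Rightarrow> real \<Rightarrow> nat \<Rightarrow> (nat \<Rightarrow> 'w \<Rightarrow> real) \<Rightarrow> (nat \<Rightarrow> 'w \<Rightarrow> real ^ 'd) \<Rightarrow> 'w \<Rightarrow> real ^ 'd" where
  "flight_position c t n \<tau> V \<omega> =
     c *\<^sub>R (\<Sum>j=1..n + 1. duration t n (\<lambda>i. \<tau> i \<omega>) j *\<^sub>R V j \<omega>)"

lemma measurable_hyperspherical:
  "(hyperspherical :: _ \<Rightarrow> real ^ 'd) \<in> PiM {..<CARD('d) - 1} (\<lambda>_. lborel) \<rightarrow>\<^sub>M borel"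
proof -
  have comp: "(\<lambda>\<theta>. \<theta> i) \<in> borel_measurable (PiM {..<CARD('d) - 1} (\<lambda>_. lborel))"
    if "i < CARD('d) - 1" for i
    using measurable_component_singleton[of i "{..<CARD('d) - 1}" "\<lambda>_. lborel :: real measure"] that
    by simp
  have "(\<lambda>\<theta>. hyperspherical_coord CARD('d) \<theta> k)
          \<in> borel_measurable (PiM {..<CARD('d) - 1} (\<lambda>_. lborel))" if "k < CARD('d)" for k
    unfolding hyperspherical_coord_def using that
    by (cases "k < CARD('d) - 1")
       (auto intro!: borel_measurable_times borel_measurable_prod
          borel_measurable_sin borel_measurable_cos comp)
  moreover have "to_nat_on (UNIV :: 'd set) i < CARD('d)" for i
    using to_nat_on_finite[of "UNIV :: 'd set"] by (auto simp: bij_betw_def)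
  ultimately show ?thesis
    by (subst borel_measurable_euclidean_space)
       (auto simp: hyperspherical_def Basis_vec_def inner_axis)
qed

lemma measurable_hyperspherical_density:
  assumes "d \<ge> 2"
  shows "hyperspherical_density d \<in> borel_measurable (PiM {..<d - 1} (\<lambda>_. lborel))"
proof -
  let ?N = "PiM {..<d - 1} (\<lambda>_. lborel) :: (nat \<Rightarrow> real) measure"
  have comp: "(\<lambda>\<theta>. \<theta> i) \<in> borel_measurable ?N" if "i < d - 1" for i
    using measurable_component_singleton[of i "{..<d - 1}" "\<lambda>_. lborel :: real measure"] that
    by simp
  have box: "{\<theta> \<in> space ?N. (\<forall>i\<in>{..<d - 2}. 0 \<le> \<theta> i \<and> \<theta> i \<le> pi) \<and>
      0 \<le> \<theta> (d - 2) \<and> \<theta> (d - 2) \<le> 2 * pi} \<in> sets ?N"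
    using assms
    by (intro sets.sets_Collect_conj sets.sets_Collect_finite_All borel_measurable_le
          borel_measurable_const comp) auto
  have prod: "(\<lambda>\<theta>. \<Prod>i<d - 2. sin (\<theta> i) ^ (d - 2 - i)) \<in> borel_measurable ?N"
    by (intro borel_measurable_prod borel_measurable_power borel_measurable_sin comp) auto
  show ?thesis
    unfolding hyperspherical_density_def[abs_def]
    by (intro measurable_If borel_measurable_times borel_measurable_const prod
          box[unfolded Ball_def lessThan_iff])
qed

lemma measurable_rescaled_dirichlet_density:
  "rescaled_dirichlet_density a t n \<in> borel_measurable (PiM {1..n} (\<lambda>_. lborel))"
proof -
  let ?N = "PiM {1..n} (\<lambda>_. lborel) :: (nat \<Rightarrow> real) measure"
  have comp: "(\<lambda>s. s j) \<in> borel_measurable ?N" if "j \<in> {1..n}" for j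
    using measurable_component_singleton[of j "{1..n}" "\<lambda>_. lborel :: real measure"] that by simp
  have sum: "(\<lambda>s. \<Sum>j=1..n. s j) \<in> borel_measurable ?N"
    by (intro borel_measurable_sum comp)
  have dur: "(\<lambda>s. duration t n s j) \<in> borel_measurable ?N" if "j \<in> {1..n + 1}" for j
    using that comp sum unfolding duration_def by (cases "j = n + 1") auto
  have "{s \<in> space ?N. (\<forall>j\<in>{1..n}. 0 < s j) \<and> (\<Sum>j=1..n. s j) < t} \<in> sets ?N"
    by (intro sets.sets_Collect_conj sets.sets_Collect_finite_All borel_measurable_less
          borel_measurable_const comp sum) auto
  moreover have "(\<lambda>s. \<Prod>j=1..n + 1. duration t n s j powr (a - 1)) \<in> borel_measurable ?N"
    by (intro borel_measurable_prod powr_real_measurable dur borel_measurable_const)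
  ultimately show ?thesis
    unfolding rescaled_dirichlet_density_def[abs_def]
    by (intro measurable_If borel_measurable_times) auto
qed

end

theory Submission
  imports Defs
begin

text \<open>Both the position and the claimed density live on a ball, and a finite measure on a ball is
  determined by its exponential moments (Stone--Weierstrass applied to the algebra spanned by the
  functions \<open>x \<mapsto> exp (\<alpha> \<bullet> x)\<close>), so it suffices to compare these moments. After symmetrisation they
  are power series with nonnegative terms, so integrals and sums may be interchanged freely.

  With \<open>\<Phi>\<^sub>h(z) = \<Sum>\<^sub>k \<Gamma>(h) z\<^sup>k / (4\<^sup>k k! \<Gamma>(h + k))\<close>, the uniform law on the sphere has exponential
  moment \<open>\<Phi>\<^bsub>d/2\<^esub>(\<parallel>\<alpha>\<parallel>\<^sup>2)\<close>, and the density proportional to \<open>(R\<^sup>2 - \<parallel>x\<parallel>\<^sup>2)\<^bsup>b-1\<^esup>\<close> has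
  \<open>\<Phi>\<^bsub>b+d/2\<^esub>(R\<^sup>2\<parallel>\<alpha>\<parallel>\<^sup>2)\<close>. Conditioning on the durations turns the moment of the position into a
  Dirichlet integral of a product of factors \<open>\<Phi>\<^bsub>d/2\<^esub>\<close>, that is, an iterated convolution. It
  closes up because the coefficients \<open>(p)\<^bsub>2k\<^esub> / (4\<^sup>k k! (h(p))\<^sub>k)\<close> form a convolution semigroup in the
  Dirichlet parameter \<open>p\<close> in exactly the two cases at hand: for \<open>h(p) = (p + 1)/2\<close> by Vandermonde's
  identity, and for \<open>h(p) = p + 1\<close> by the Rothe--Hagen identity.\<close>

section \<open>Fractional integration kernels and Bessel-type series\<close>

text \<open>Padding row \<open>i\<close> with \<open>i\<close> leading zeros turns the double series
  into a sum over a triangle, and monotone convergence swaps the two summations. In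
  \<open>ennreal\<close> no summability has to be checked.\<close>

lemma suminf_ennreal_Cauchy_product:
  fixes f :: "nat \<Rightarrow> nat \<Rightarrow> ennreal"
  shows "(\<Sum>i. \<Sum>j. f i j) = (\<Sum>k. \<Sum>i\<le>k. f i (k - i))"
proof -
  let ?g = "\<lambda>i k. if i \<le> k then f i (k - i) else 0"
  have row: "(\<Sum>j. f i j) = (\<Sum>k. ?g i k)" for i
    by (subst suminf_offset[of "?g i" i]) auto
  have "(\<Sum>i. \<Sum>j. f i j) = (\<Sum>i. \<Sum>k. ?g i k)"
    by (simp only: row)
  also have "\<dots> = (\<Sum>i. \<integral>\<^sup>+k. ?g i k \<partial>count_space UNIV)"
    by (simp only: nn_integral_count_space_nat)
  also have "\<dots> = (\<integral>\<^sup>+k. (\<Sum>i. ?g i k) \<partial>count_space UNIV)"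
    by (rule nn_integral_suminf[symmetric]) simp
  also have "\<dots> = (\<Sum>k. \<Sum>i. ?g i k)"
    by (rule nn_integral_count_space_nat)
  also have "(\<lambda>k. \<Sum>i. ?g i k) = (\<lambda>k. \<Sum>i\<le>k. f i (k - i))"
    by (rule ext, subst suminf_finite[of "{.._}"]) auto
  finally show ?thesis .
qed

text \<open>The Riemann-Liouville kernel of fractional integration of order \<open>p\<close>. The
  value 0 for \<open>s \<le> 0\<close> builds the support into the function, so integrals over
  intervals, balls and simplices can be written over the whole space.\<close>

definition frac_kernel :: "real \<Rightarrow> real \<Rightarrow> real" where
  "frac_kernel p s = (if 0 < s then s powr (p - 1) / Gamma p else 0)"

lemma frac_kernel_nonneg: "p > 0 \<Longrightarrow> 0 \<le> frac_kernel p s"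
  by (simp add: frac_kernel_def Gamma_real_pos less_imp_le)

lemma borel_measurable_frac_kernel [measurable]: "frac_kernel p \<in> borel_measurable borel"
  unfolding frac_kernel_def[abs_def] by measurable

text \<open>The substitution \<open>x = t * u\<close> leaves a Beta integral, and
  \<open>Beta p q\<close> turns the factor \<open>1 / (Gamma p * Gamma q)\<close> into
  \<open>1 / Gamma (p + q)\<close>. For \<open>t \<le> 0\<close> the arguments \<open>x\<close> and
  \<open>t - x\<close> are never both positive.\<close>

lemma frac_kernel_convolution:
  assumes p: "p > 0" and q: "q > 0"
  shows "(\<integral>\<^sup>+x. ennreal (frac_kernel p x) * ennreal (frac_kernel q (t - x)) \<partial>lborel)
           = ennreal (frac_kernel (p + q) t)"
proof (cases "t > 0")
  case False
  then have "frac_kernel p x * frac_kernel q (t - x) = 0" for x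
    by (auto simp: frac_kernel_def)
  then show ?thesis
    using False p q by (subst nn_integral_cong[of _ _ "\<lambda>_. 0"])
      (auto simp: ennreal_mult[symmetric] frac_kernel_nonneg frac_kernel_def[of "p + q"])
next
  case True
  let ?G = "Gamma p * Gamma q"
  have G: "?G > 0" using p q by (simp add: Gamma_real_pos)
  have "(\<integral>\<^sup>+x. ennreal (frac_kernel p x) * ennreal (frac_kernel q (t - x)) \<partial>lborel)
      = ennreal t * (\<integral>\<^sup>+u. ennreal (frac_kernel p (t * u)) * ennreal (frac_kernel q (t - t * u)) \<partial>lborel)"
    using True by (subst nn_integral_real_affine[where t = 0 and c = t]) auto
  also have "(\<integral>\<^sup>+u. ennreal (frac_kernel p (t * u)) * ennreal (frac_kernel q (t - t * u)) \<partial>lborel)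
      = (\<integral>\<^sup>+u. ennreal (t powr (p + q - 2) / ?G) *
           (ennreal (u powr (p - 1) * (1 - u) powr (q - 1)) * indicator {0..1} u) \<partial>lborel)"
  proof (intro nn_integral_cong_AE AE_I[of _ _ "{0, 1}"])
    show "{u \<in> space lborel. ennreal (frac_kernel p (t * u)) * ennreal (frac_kernel q (t - t * u))
        \<noteq> ennreal (t powr (p + q - 2) / ?G) *
           (ennreal (u powr (p - 1) * (1 - u) powr (q - 1)) * indicator {0..1} u)} \<subseteq> {0, 1}"
    proof (safe, simp_all, rule ccontr)
      fix u :: real
      assume ne: "ennreal (frac_kernel p (t * u)) * ennreal (frac_kernel q (t - t * u))
        \<noteq> ennreal (t powr (p + q - 2) / ?G) *
           (ennreal (u powr (p - 1) * (1 - u) powr (q - 1)) * indicator {0..1} u)"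
        and u: "u \<noteq> 0" "u \<noteq> 1"
      have pos: "0 < t - t * u \<longleftrightarrow> u < 1" "0 < t * u \<longleftrightarrow> 0 < u"
        using True by (simp_all add: zero_less_mult_iff)
      have "frac_kernel p (t * u) * frac_kernel q (t - t * u)
          = t powr (p + q - 2) / ?G * (u powr (p - 1) * (1 - u) powr (q - 1) * indicator {0..1} u)"
      proof (cases "0 < u \<and> u < 1")
        case True
        have "(t - t * u) = t * (1 - u)" by (simp add: algebra_simps)
        then have "(t * u) powr (p - 1) * (t - t * u) powr (q - 1)
            = (t powr (p - 1) * t powr (q - 1)) * (u powr (p - 1) * (1 - u) powr (q - 1))"
          using True \<open>t > 0\<close> by (simp add: powr_mult)
        also have "t powr (p - 1) * t powr (q - 1) = t powr (p + q - 2)"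
          by (simp add: powr_add[symmetric] algebra_simps)
        finally show ?thesis
          using True pos by (simp add: frac_kernel_def)
      next
        case False
        with pos u show ?thesis by (auto simp: frac_kernel_def indicator_def)
      qed
      then show False
        using ne p q G by (simp add: ennreal_mult'[symmetric] frac_kernel_nonneg ennreal_indicator[symmetric]
            mult.assoc)
    qed
  qed (auto simp: emeasure_lborel_countable)
  also have "\<dots> = ennreal (t powr (p + q - 2) / ?G) * ennreal (Beta p q)"
    using nn_integral_has_integral_lebesgue'[OF _ has_integral_Beta_real[OF p q]]
    by (subst nn_integral_cmult) (auto simp: set_borel_measurable_def)
  also have "ennreal t * \<dots> = ennreal (frac_kernel (p + q) t)"
  proof -
    have "Beta p q \<ge> 0" using p q by (simp add: Beta_def Gamma_real_pos less_imp_le)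
    moreover have "t * (t powr (p + q - 2) / ?G * Beta p q) = frac_kernel (p + q) t"
    proof -
      have "t * t powr (p + q - 2) = t powr (p + q - 1)"
        using True powr_add[of t 1 "p + q - 2"] by (simp add: algebra_simps)
      then show ?thesis
        using True G by (auto simp: frac_kernel_def Beta_def)
    qed
    ultimately show ?thesis
      using True G by (simp add: ennreal_mult'[symmetric])
  qed
  finally show ?thesis .
qed

section \<open>Integrals of even functions against the kernels\<close>

lemma nn_integral_even:
  assumes [measurable]: "f \<in> borel_measurable borel"
    and even: "\<And>x. f (- x) = f (x :: real)"
  shows "(\<integral>\<^sup>+x. f x \<partial>lborel) = 2 * (\<integral>\<^sup>+x. f x * indicator {0<..} x \<partial>lborel)"
proof -
  have "(\<integral>\<^sup>+x. f x \<partial>lborel) = (\<integral>\<^sup>+x. f x * indicator {0<..} x + f x * indicator {..<0} x \<partial>lborel)"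
    by (intro nn_integral_cong_AE AE_I[of _ _ "{0}"]) (auto simp: indicator_def)
  also have "\<dots> = (\<integral>\<^sup>+x. f x * indicator {0<..} x \<partial>lborel) + (\<integral>\<^sup>+x. f x * indicator {..<0} x \<partial>lborel)"
    by (rule nn_integral_add) auto
  also have "(\<integral>\<^sup>+x. f x * indicator {..<0} x \<partial>lborel) = (\<integral>\<^sup>+x. f x * indicator {0<..} x \<partial>lborel)"
    by (subst nn_integral_real_affine[of _ "-1" 0])
      (auto simp: indicator_def even intro!: nn_integral_cong)
  finally show ?thesis by (simp add: mult_2)
qed

text \<open>Under \<open>u = x^2\<close> on the positive half-line, \<open>x^(2i) dx\<close> becomes
  \<open>u^(i - 1/2) du / 2\<close>, a multiple of the kernel of order \<open>i + 1/2\<close>. The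
  integral is therefore a convolution of two kernels evaluated at \<open>s\<close>.\<close>

lemma nn_integral_even_power_frac_kernel:
  assumes p: "p > 0"
  shows "(\<integral>\<^sup>+x. ennreal (x ^ (2 * i)) * ennreal (frac_kernel p (s - x\<^sup>2)) \<partial>lborel)
           = ennreal (Gamma (real i + 1/2) * frac_kernel (p + real i + 1/2) s)"
proof (cases "s > 0")
  case False
  then have "frac_kernel p (s - x\<^sup>2) = 0" for x
    using zero_le_power2[of x] order_trans[OF zero_le_power2, of x s]
    by (cases "x\<^sup>2 < s") (simp_all add: frac_kernel_def)
  then show ?thesis using False by (simp add: frac_kernel_def[of _ s])
next
  case True
  let ?G = "Gamma (real i + 1/2)"
  let ?h = "\<lambda>u. frac_kernel (real i + 1/2) u * frac_kernel p (s - u)"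
  have G: "?G > 0" by (simp add: Gamma_real_pos)
  have nn: "0 \<le> ?h u" for u using p by (intro mult_nonneg_nonneg frac_kernel_nonneg) auto
  have "ennreal (frac_kernel (p + real i + 1/2) s) = (\<integral>\<^sup>+u. ennreal (?h u) \<partial>lborel)"
    using frac_kernel_convolution[of "real i + 1/2" p s] p
    by (simp add: ennreal_mult frac_kernel_nonneg add_ac)
  \<comment> \<open>The integrand vanishes outside the open interval from 0 to \<open>s\<close>. The
    endpoints are written as squares because the substitution rule expects the images of 0 and
    \<open>sqrt s\<close>.\<close>
  also have "\<dots> = (\<integral>\<^sup>+u. ennreal (?h u * indicator {0\<^sup>2..(sqrt s)\<^sup>2} u) \<partial>lborel)"
    using True by (intro nn_integral_cong) (auto simp: frac_kernel_def indicator_def)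
  also have "\<dots> = (\<integral>\<^sup>+x. ennreal (?h (x\<^sup>2) * (2 * x) * indicator {0..sqrt s} x) \<partial>lborel)"
    using True
    by (subst nn_integral_substitution[where g = "\<lambda>x. x\<^sup>2" and g' = "\<lambda>x. 2 * x"])
       (auto intro!: derivative_eq_intros continuous_intros simp: set_borel_measurable_def)
  also have "\<dots> = (\<integral>\<^sup>+x. ennreal (2 / ?G) *
      (ennreal (x ^ (2 * i)) * ennreal (frac_kernel p (s - x\<^sup>2)) * indicator {0<..} x) \<partial>lborel)"
  proof (intro nn_integral_cong)
    fix x :: real
    have "?h (x\<^sup>2) * (2 * x) * indicator {0..sqrt s} x
        = 2 / ?G * (x ^ (2 * i) * frac_kernel p (s - x\<^sup>2) * indicator {0<..} x)"
    proof (cases "0 < x")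
      case x: True
      have "x\<^sup>2 powr (real i - 1/2) * x = x ^ (2 * i)"
      proof -
        have "x\<^sup>2 powr (real i - 1/2) = x powr (2 * real i - 1)"
          using x by (simp add: powr_powr powr_numeral[symmetric] algebra_simps del: powr_numeral)
        also have "\<dots> * x = x powr (2 * real i)"
          using x powr_add[of x "2 * real i - 1" 1] by simp
        also have "\<dots> = x ^ (2 * i)"
          using x powr_realpow[of x "2 * i"] by simp
        finally show ?thesis .
      qed
      moreover have "frac_kernel p (s - x\<^sup>2) = 0" if "\<not> x \<le> sqrt s"
        using that x True real_le_rsqrt[of x s] by (auto simp: frac_kernel_def)
      moreover have "frac_kernel (real i + 1/2) (x\<^sup>2) * x = x\<^sup>2 powr (real i - 1/2) * x / ?G"
        using x by (simp add: frac_kernel_def)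
      moreover have "?h (x\<^sup>2) * (2 * x) = 2 * frac_kernel p (s - x\<^sup>2) * (frac_kernel (real i + 1/2) (x\<^sup>2) * x)"
        by simp
      ultimately show ?thesis
        using x by (auto simp: indicator_def)
    qed (auto simp: indicator_def)
    then show "ennreal (?h (x\<^sup>2) * (2 * x) * indicator {0..sqrt s} x) = ennreal (2 / ?G) *
      (ennreal (x ^ (2 * i)) * ennreal (frac_kernel p (s - x\<^sup>2)) * indicator {0<..} x)"
      using G p by (simp add: ennreal_mult'[symmetric] frac_kernel_nonneg
          ennreal_indicator[symmetric])
  qed
  also have "\<dots> = ennreal (1 / ?G) *
      (2 * (\<integral>\<^sup>+x. ennreal (x ^ (2 * i)) * ennreal (frac_kernel p (s - x\<^sup>2)) * indicator {0<..} x \<partial>lborel))"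
  proof -
    have "ennreal (2 / ?G) = ennreal (1 / ?G) * 2"
      using G ennreal_mult'[of "1 / ?G" 2] by (simp add: mult.commute)
    then show ?thesis by (subst nn_integral_cmult) (auto simp: mult.assoc)
  qed
  also have "\<dots> = ennreal (1 / ?G) *
      (\<integral>\<^sup>+x. ennreal (x ^ (2 * i)) * ennreal (frac_kernel p (s - x\<^sup>2)) \<partial>lborel)"
    by (subst nn_integral_even[of "\<lambda>x. ennreal (x ^ (2 * i)) * ennreal (frac_kernel p (s - x\<^sup>2))"]) auto
  finally have "ennreal ?G * ennreal (frac_kernel (p + real i + 1/2) s) = ennreal ?G * \<dots>"
    by simp
  also have "\<dots> = (\<integral>\<^sup>+x. ennreal (x ^ (2 * i)) * ennreal (frac_kernel p (s - x\<^sup>2)) \<partial>lborel)"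
    using G less_imp_neq[OF G, symmetric]
    by (simp add: mult.assoc[symmetric] ennreal_mult'[symmetric])
  finally show ?thesis using G by (simp add: ennreal_mult')
qed

lemma suminf_ennreal_cosh:
  "(\<Sum>i. ennreal (y ^ (2 * i) / fact (2 * i))) = ennreal (cosh (y :: real))"
proof -
  have "(\<lambda>i. (if even i then y ^ i /\<^sub>R fact i else 0)) sums cosh y"
    by (rule cosh_converges)
  then have "(\<lambda>i. y ^ (2 * i) / fact (2 * i)) sums cosh y"
    by (subst (asm) sums_mono_reindex[of "\<lambda>i. 2 * i", symmetric])
      (auto simp: strict_mono_def divide_inverse mult_ac elim!: evenE)
  then show ?thesis by (intro suminf_ennreal_eq) auto
qed

text \<open>Up to normalisation, \<open>bessel_kernel b z s\<close> is \<open>s\<^bsup>(b-1)/2\<^esup> I\<^bsub>b-1\<^esub>(\<surd>(z s))\<close> with the modified Bessel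
  function \<open>I\<close>; at \<open>s = 1\<close> it is the function \<open>\<Phi>\<^sub>b(z) / \<Gamma>(b)\<close> of the introduction.\<close>

definition bessel_kernel :: "real \<Rightarrow> real \<Rightarrow> real \<Rightarrow> ennreal" where
  "bessel_kernel b z s = (\<Sum>k. ennreal ((z / 4) ^ k / fact k * frac_kernel (b + real k) s))"

lemma borel_measurable_bessel_kernel [measurable]:
  "bessel_kernel b z \<in> borel_measurable borel"
  unfolding bessel_kernel_def[abs_def] by measurable

text \<open>The factor \<open>F (x^2)\<close> is even, so the odd part of the exponential integrates
  away. Unlike the exponential series at a negative argument, the series of \<open>cosh\<close> has
  only nonnegative terms, so it can be integrated termwise in \<open>ennreal\<close>.\<close>

lemma nn_integral_exp_even:
  assumes [measurable]: "F \<in> borel_measurable borel"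
  shows "(\<integral>\<^sup>+x. ennreal (exp (a * x)) * F (x\<^sup>2) \<partial>lborel)
       = (\<integral>\<^sup>+x. ennreal (cosh (a * x)) * F (x\<^sup>2) \<partial>(lborel :: real measure))"
proof -
  let ?I = "\<lambda>a. \<integral>\<^sup>+x. ennreal (exp (a * x)) * F (x\<^sup>2) \<partial>(lborel :: real measure)"
  have I: "?I (- a) = ?I a"
    by (subst nn_integral_real_affine[of _ "-1" 0]) auto
  have half: "ennreal (cosh (a * x)) = ennreal (1/2) * ennreal (exp (a * x)) + ennreal (1/2) * ennreal (exp (- a * x))" for x
  proof -
    have "cosh (a * x) = 1/2 * exp (a * x) + 1/2 * exp (- a * x)"
      by (simp add: cosh_field_def)
    also have "ennreal \<dots> = ennreal (1/2 * exp (a * x)) + ennreal (1/2 * exp (- a * x))"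
      by (rule ennreal_plus) auto
    also have "ennreal (1/2 * exp (a * x)) = ennreal (1/2) * ennreal (exp (a * x))"
      by (rule ennreal_mult') simp
    also have "ennreal (1/2 * exp (- a * x)) = ennreal (1/2) * ennreal (exp (- a * x))"
      by (rule ennreal_mult') simp
    finally show ?thesis .
  qed
  have "(\<integral>\<^sup>+x. ennreal (cosh (a * x)) * F (x\<^sup>2) \<partial>(lborel :: real measure))
      = (\<integral>\<^sup>+x. ennreal (1/2) * (ennreal (exp (a * x)) * F (x\<^sup>2))
           + ennreal (1/2) * (ennreal (exp (- a * x)) * F (x\<^sup>2)) \<partial>lborel)"
    by (intro nn_integral_cong)
      (simp only: mult.assoc[symmetric] distrib_right[symmetric] half)
  also have "\<dots> = ennreal (1/2) * ?I a + ennreal (1/2) * ?I (- a)"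
    by (subst nn_integral_add) (auto simp: nn_integral_cmult)
  also have "\<dots> = ?I a"
    unfolding I distrib_right[symmetric] by (subst ennreal_plus[symmetric]) auto
  finally show ?thesis by simp
qed

lemma pos_notin_nonpos_Ints: "x > 0 \<Longrightarrow> (x :: real) \<notin> \<int>\<^sub>\<le>\<^sub>0"
  by (auto elim!: nonpos_Ints_cases)

text \<open>Legendre duplication at half-integers. It turns the \<open>(2i)!\<close> of the
  \<open>cosh\<close> series into the \<open>4^i i!\<close> of the Bessel series.\<close>

lemma Gamma_half_div_fact:
  "Gamma (real i + 1/2) / fact (2 * i) = sqrt pi / (4 ^ i * fact i)"
proof -
  have "Gamma (real i + 1/2) = pochhammer (1/2) i * sqrt pi"
    using pochhammer_Gamma[OF pos_notin_nonpos_Ints, of "1/2" i]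
    by (simp add: Gamma_one_half_real add.commute)
  moreover have "pochhammer (1/2 :: real) i > 0" by (rule pochhammer_pos) simp
  moreover have "(fact (2 * i) :: real) = 4 ^ i * pochhammer (1/2) i * fact i"
    using fact_double[of i, where ?'a = real] by (simp add: power_mult)
  ultimately show ?thesis by (simp add: field_simps)
qed

lemma sum_power_div_fact:
  "(\<Sum>i\<le>k. x ^ i / fact i * (y ^ (k - i) / fact (k - i))) = (x + y :: real) ^ k / fact k"
proof -
  have "(x + y) ^ k / fact k = (\<Sum>i\<le>k. of_nat (k choose i) * x ^ i * y ^ (k - i) / fact k)"
    by (simp add: binomial_ring sum_divide_distrib)
  also have "\<dots> = (\<Sum>i\<le>k. x ^ i / fact i * (y ^ (k - i) / fact (k - i)))"
    by (intro sum.cong) (auto simp: binomial_fact)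
  finally show ?thesis ..
qed

text \<open>Termwise integration sends the term \<open>(i, j)\<close> of the two series to a kernel
  whose order depends only on \<open>i + j\<close>. Summing along diagonals, the binomial theorem
  merges \<open>z\<close> and \<open>a^2\<close> into \<open>z + a^2\<close>. Integrating out one
  cartesian coordinate thus raises the index by one half.\<close>

lemma nn_integral_exp_bessel_kernel:
  assumes b: "b > 0" and z: "z \<ge> 0"
  shows "(\<integral>\<^sup>+x. ennreal (exp (a * x)) * bessel_kernel b z (s - x\<^sup>2) \<partial>lborel)
           = ennreal (sqrt pi) * bessel_kernel (b + 1/2) (z + a\<^sup>2) s"
proof -
  let ?c = "\<lambda>i. a ^ (2 * i) / fact (2 * i)" and ?d = "\<lambda>j. (z / 4) ^ j / fact j"
  have fk: "0 \<le> frac_kernel (b + real j) y" for j y using b by (intro frac_kernel_nonneg) auto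
  have fk2: "0 \<le> frac_kernel (b + 1/2 + real j) y" for j y using b by (intro frac_kernel_nonneg) auto
  have "(\<integral>\<^sup>+x. ennreal (exp (a * x)) * bessel_kernel b z (s - x\<^sup>2) \<partial>lborel)
      = (\<integral>\<^sup>+x. ennreal (cosh (a * x)) * bessel_kernel b z (s - x\<^sup>2) \<partial>lborel)"
    by (rule nn_integral_exp_even) measurable
  also have "\<dots> = (\<integral>\<^sup>+x. (\<Sum>i. \<Sum>j. ennreal (?c i * ?d j) *
      (ennreal (x ^ (2 * i)) * ennreal (frac_kernel (b + real j) (s - x\<^sup>2)))) \<partial>lborel)"
    (is "_ = (\<integral>\<^sup>+x. (\<Sum>i. \<Sum>j. ?e i j x) \<partial>lborel)")
  proof (intro nn_integral_cong)
    fix x :: real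
    have "ennreal (cosh (a * x)) * bessel_kernel b z (s - x\<^sup>2)
      = (\<Sum>i. \<Sum>j. ennreal ((a * x) ^ (2 * i) / fact (2 * i))
           * ennreal (?d j * frac_kernel (b + real j) (s - x\<^sup>2)))"
      by (simp only: suminf_ennreal_cosh[symmetric] bessel_kernel_def ennreal_suminf_cmult
          ennreal_suminf_multc)
    also have "\<dots> = (\<Sum>i. \<Sum>j. ?e i j x)"
    proof (intro suminf_cong)
      fix i j
      have "ennreal ((a * x) ^ (2 * i) / fact (2 * i)) * ennreal (?d j * frac_kernel (b + real j) (s - x\<^sup>2))
          = ennreal ((a * x) ^ (2 * i) / fact (2 * i) * (?d j * frac_kernel (b + real j) (s - x\<^sup>2)))"
        by (rule ennreal_mult'[symmetric]) simp
      also have "\<dots> = ennreal ((?c i * ?d j) * (x ^ (2 * i) * frac_kernel (b + real j) (s - x\<^sup>2)))"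
        by (simp add: power_mult_distrib mult_ac)
      also have "\<dots> = ?e i j x"
        using z by (subst ennreal_mult') (auto simp: ennreal_mult'[of "x ^ (2 * i)"])
      finally show "ennreal ((a * x) ^ (2 * i) / fact (2 * i)) *
        ennreal (?d j * frac_kernel (b + real j) (s - x\<^sup>2)) = ?e i j x" .
    qed
    finally show "ennreal (cosh (a * x)) * bessel_kernel b z (s - x\<^sup>2) = (\<Sum>i. \<Sum>j. ?e i j x)" .
  qed
  also have "\<dots> = (\<Sum>i. \<Sum>j. \<integral>\<^sup>+x. ?e i j x \<partial>lborel)"
    by (subst nn_integral_suminf, measurable, subst nn_integral_suminf, measurable)
  also have "(\<lambda>i j. \<integral>\<^sup>+x. ?e i j x \<partial>lborel) = (\<lambda>i j. ennreal (sqrt pi *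
      (((a\<^sup>2 / 4) ^ i / fact i * ?d j) * frac_kernel (b + 1/2 + real (i + j)) s)))"
  proof (intro ext)
    fix i j
    have "(\<integral>\<^sup>+x. ?e i j x \<partial>lborel) = ennreal (?c i * ?d j) *
        ennreal (Gamma (real i + 1/2) * frac_kernel (b + real j + real i + 1/2) s)"
      using b by (subst nn_integral_cmult) (auto simp: nn_integral_even_power_frac_kernel)
    also have "\<dots> = ennreal ((?c i * ?d j) * (Gamma (real i + 1/2) * frac_kernel (b + real j + real i + 1/2) s))"
      using z by (intro ennreal_mult'[symmetric]) auto
    also have "(?c i * ?d j) * (Gamma (real i + 1/2) * frac_kernel (b + real j + real i + 1/2) s)
        = a ^ (2 * i) * (Gamma (real i + 1/2) / fact (2 * i)) * ?d j * frac_kernel (b + real j + real i + 1/2) s"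
      by simp
    also have "\<dots> = sqrt pi * (((a\<^sup>2 / 4) ^ i / fact i * ?d j) * frac_kernel (b + 1/2 + real (i + j)) s)"
      unfolding Gamma_half_div_fact by (simp add: power_mult power_divide add_ac)
    finally show "(\<integral>\<^sup>+x. ?e i j x \<partial>lborel) = ennreal (sqrt pi *
      (((a\<^sup>2 / 4) ^ i / fact i * ?d j) * frac_kernel (b + 1/2 + real (i + j)) s))" .
  qed
  also have "(\<Sum>i. \<Sum>j. ennreal (sqrt pi *
      (((a\<^sup>2 / 4) ^ i / fact i * ?d j) * frac_kernel (b + 1/2 + real (i + j)) s)))
    = (\<Sum>k. \<Sum>i\<le>k. ennreal (sqrt pi *
      (((a\<^sup>2 / 4) ^ i / fact i * ?d (k - i)) * frac_kernel (b + 1/2 + real k) s)))"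
    by (subst suminf_ennreal_Cauchy_product) (intro suminf_cong sum.cong, auto)
  also have "\<dots> = (\<Sum>k. ennreal (sqrt pi) *
      ennreal (((z + a\<^sup>2) / 4) ^ k / fact k * frac_kernel (b + 1/2 + real k) s))"
  proof (intro suminf_cong)
    fix k
    have "(\<Sum>i\<le>k. ennreal (sqrt pi * (((a\<^sup>2 / 4) ^ i / fact i * ?d (k - i)) * frac_kernel (b + 1/2 + real k) s)))
      = ennreal (\<Sum>i\<le>k. sqrt pi * (((a\<^sup>2 / 4) ^ i / fact i * ?d (k - i)) * frac_kernel (b + 1/2 + real k) s))"
      using z fk2 by (intro sum_ennreal) auto
    also have "(\<Sum>i\<le>k. sqrt pi * (((a\<^sup>2 / 4) ^ i / fact i * ?d (k - i)) * frac_kernel (b + 1/2 + real k) s))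
      = sqrt pi * ((\<Sum>i\<le>k. (a\<^sup>2 / 4) ^ i / fact i * ?d (k - i)) * frac_kernel (b + 1/2 + real k) s)"
      by (simp only: sum_distrib_left sum_distrib_right)
    also have "\<dots> = sqrt pi * (((z + a\<^sup>2) / 4) ^ k / fact k * frac_kernel (b + 1/2 + real k) s)"
      by (simp only: sum_power_div_fact add_divide_distrib add.commute)
    finally show "(\<Sum>i\<le>k. ennreal (sqrt pi * (((a\<^sup>2 / 4) ^ i / fact i * ?d (k - i)) * frac_kernel (b + 1/2 + real k) s)))
      = ennreal (sqrt pi) * ennreal (((z + a\<^sup>2) / 4) ^ k / fact k * frac_kernel (b + 1/2 + real k) s)"
      by (simp only: ennreal_mult'[OF real_sqrt_ge_zero[OF pi_ge_zero]])
  qed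
  finally show ?thesis by (simp add: bessel_kernel_def)
qed

section \<open>Exponential moments of radial densities\<close>

lemma bessel_kernel_zero:
  "b > 0 \<Longrightarrow> bessel_kernel b 0 s = ennreal (frac_kernel b s)"
  unfolding bessel_kernel_def by (subst suminf_finite[of "{0}"]) (auto simp: power_0_left)

lemma bessel_kernel_nonpos: "s \<le> 0 \<Longrightarrow> bessel_kernel b z s = 0"
  by (simp add: bessel_kernel_def frac_kernel_def)

text \<open>Homogeneity: the \<open>k\<close>-th term gains \<open>r^(b - 1) r^k\<close>, and
  \<open>r^k\<close> is absorbed into \<open>z^k\<close>. A scaling of the argument can so be traded
  for one of the parameter.\<close>

lemma bessel_kernel_scale:
  assumes r: "r > 0" and b: "b > 0" and z: "z \<ge> 0"
  shows "bessel_kernel b z (r * s) = ennreal (r powr (b - 1)) * bessel_kernel b (r * z) s"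
proof -
  have "(z / 4) ^ k / fact k * frac_kernel (b + real k) (r * s)
      = r powr (b - 1) * ((r * z / 4) ^ k / fact k * frac_kernel (b + real k) s)" for k
  proof (cases "s > 0")
    case True
    have "(r * s) powr (b + real k - 1) = r powr (b - 1) * r ^ k * s powr (b + real k - 1)"
      using r True powr_add[of r "b - 1" "real k"]
      by (simp add: powr_mult powr_realpow[symmetric] algebra_simps)
    then show ?thesis
      using True r by (simp add: frac_kernel_def power_mult_distrib power_divide)
  next
    case False
    then show ?thesis using r by (simp add: frac_kernel_def zero_less_mult_iff)
  qed
  then show ?thesis
    unfolding bessel_kernel_def
    by (simp only: ennreal_mult'[OF powr_ge_zero] ennreal_suminf_cmult)
qed

text \<open>Induction over the coordinates. The inserted one is integrated first, with
  \<open>s\<close> lowered by the squares of the others; this replaces \<open>(b, z)\<close> by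
  \<open>(b + 1/2, z + (a i)^2)\<close>, so both must stay general in the induction.\<close>

lemma nn_integral_PiM_exp_bessel_kernel:
  assumes "finite I" "b > 0" "z \<ge> 0"
  shows "(\<integral>\<^sup>+f. ennreal (exp (\<Sum>i\<in>I. a i * f i)) * bessel_kernel b z (s - (\<Sum>i\<in>I. (f i)\<^sup>2))
             \<partial>PiM I (\<lambda>_. lborel))
         = ennreal (sqrt pi ^ card I) * bessel_kernel (b + real (card I) / 2) (z + (\<Sum>i\<in>I. (a i)\<^sup>2)) s"
  using assms
proof (induction I arbitrary: b z rule: finite_induct)
  case empty
  then show ?case by (simp add: PiM_empty nn_integral_count_space_finite)
next
  case (insert i I)
  interpret product_sigma_finite "\<lambda>_. lborel :: real measure" by standard
  have sum: "(\<Sum>j\<in>I. h j ((f(i := y)) j)) = (\<Sum>j\<in>I. h j (f j))" for h :: "_ \<Rightarrow> real \<Rightarrow> real" and f y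
    using insert.hyps by (intro sum.cong) auto
  have "(\<integral>\<^sup>+f. ennreal (exp (\<Sum>j\<in>insert i I. a j * f j))
          * bessel_kernel b z (s - (\<Sum>j\<in>insert i I. (f j)\<^sup>2)) \<partial>PiM (insert i I) (\<lambda>_. lborel))
      = (\<integral>\<^sup>+f. (\<integral>\<^sup>+y. ennreal (exp (\<Sum>j\<in>I. a j * f j)) *
           (ennreal (exp (a i * y)) * bessel_kernel b z (s - (\<Sum>j\<in>I. (f j)\<^sup>2) - y\<^sup>2)) \<partial>lborel)
         \<partial>PiM I (\<lambda>_. lborel))"
    using insert.hyps
    by (subst product_nn_integral_insert)
      (auto simp: sum[of "\<lambda>j x. a j * x"] sum[of "\<lambda>j x. x\<^sup>2"] exp_add ennreal_mult' mult_ac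
        diff_diff_eq add.commute simp del: fun_upd_apply simp: fun_upd_same intro!: nn_integral_cong)
  also have "\<dots> = (\<integral>\<^sup>+f. ennreal (sqrt pi) * (ennreal (exp (\<Sum>j\<in>I. a j * f j)) *
           bessel_kernel (b + 1/2) (z + (a i)\<^sup>2) (s - (\<Sum>j\<in>I. (f j)\<^sup>2))) \<partial>PiM I (\<lambda>_. lborel))"
    by (intro nn_integral_cong, subst nn_integral_cmult, measurable,
        subst nn_integral_exp_bessel_kernel[OF insert.prems]) (simp only: mult.left_commute)
  also have "\<dots> = ennreal (sqrt pi) * (\<integral>\<^sup>+f. ennreal (exp (\<Sum>j\<in>I. a j * f j)) *
           bessel_kernel (b + 1/2) (z + (a i)\<^sup>2) (s - (\<Sum>j\<in>I. (f j)\<^sup>2)) \<partial>PiM I (\<lambda>_. lborel))"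
    by (rule nn_integral_cmult) measurable
  also have "\<dots> = ennreal (sqrt pi ^ card (insert i I)) *
      bessel_kernel (b + real (card (insert i I)) / 2) (z + (\<Sum>j\<in>insert i I. (a j)\<^sup>2)) s"
    using insert.prems insert.hyps
    by (subst insert.IH) (auto simp: ennreal_mult' mult_ac add_ac add_divide_distrib)
  finally show ?case .
qed

text \<open>In coordinates with respect to \<open>Basis\<close> this is the product integral started
  at \<open>z = 0\<close>, where the Bessel series reduces to its first term, the kernel
  itself.\<close>

lemma nn_integral_lborel_exp_frac_kernel:
  fixes \<alpha> :: "'a :: euclidean_space"
  assumes b: "b > 0"
  shows "(\<integral>\<^sup>+x. ennreal (exp (\<alpha> \<bullet> x)) * ennreal (frac_kernel b (s - (norm x)\<^sup>2)) \<partial>lborel)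
       = ennreal (pi powr (real DIM('a) / 2)) * bessel_kernel (b + real DIM('a) / 2) ((norm \<alpha>)\<^sup>2) s"
proof -
  have norm: "(norm x)\<^sup>2 = (\<Sum>i\<in>Basis. (x \<bullet> i)\<^sup>2)" for x :: 'a
    by (subst euclidean_inner[of x x, unfolded dot_square_norm]) (simp add: power2_eq_square)
  have "(\<integral>\<^sup>+x. ennreal (exp (\<alpha> \<bullet> x)) * ennreal (frac_kernel b (s - (norm x)\<^sup>2)) \<partial>lborel)
     = (\<integral>\<^sup>+f. ennreal (exp (\<alpha> \<bullet> (\<Sum>i\<in>Basis. f i *\<^sub>R i))) *
          ennreal (frac_kernel b (s - (norm (\<Sum>i\<in>Basis. f i *\<^sub>R i :: 'a))\<^sup>2)) \<partial>PiM Basis (\<lambda>_. lborel))"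
    by (subst lborel_eq, subst nn_integral_distr) auto
  also have "\<dots> = (\<integral>\<^sup>+f. ennreal (exp (\<Sum>i\<in>Basis. (\<alpha> \<bullet> i) * f i)) *
          bessel_kernel b 0 (s - (\<Sum>i\<in>Basis. (f i)\<^sup>2)) \<partial>PiM Basis (\<lambda>_. lborel))"
    using b by (simp add: bessel_kernel_zero norm inner_sum_right mult.commute)
  also have "\<dots> = ennreal (sqrt pi ^ DIM('a)) *
      bessel_kernel (b + real DIM('a) / 2) (0 + (\<Sum>i\<in>Basis. (\<alpha> \<bullet> i)\<^sup>2)) s"
    using b by (intro nn_integral_PiM_exp_bessel_kernel) auto
  also have "sqrt pi ^ DIM('a) = pi powr (real DIM('a) / 2)"
    by (simp add: powr_half_sqrt[symmetric] powr_realpow[symmetric] powr_powr)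
  finally show ?thesis by (simp add: norm)
qed

section \<open>Exponential moments of the uniform law on the sphere\<close>

text \<open>The substitution \<open>x = - cos y\<close> reduces an integral over a polar angle to one over a cartesian
  coordinate.\<close>

lemma nn_integral_polar_angle:
  assumes q: "q > 0" and z: "z \<ge> 0"
  shows "(\<integral>\<^sup>+y. ennreal (exp (\<beta> * cos y)) * bessel_kernel q z ((sin y)\<^sup>2) * ennreal (sin y)
             * indicator {0..pi} y \<partial>lborel)
       = ennreal (sqrt pi) * bessel_kernel (q + 1/2) (z + \<beta>\<^sup>2) 1"
proof -
  \<comment> \<open>The minus sign belongs to \<open>x = - cos y\<close>, which increases on
    \<open>{0..pi}\<close> with derivative \<open>sin y\<close>, as the substitution rule
    requires.\<close>
  let ?f = "\<lambda>x. ennreal (exp (- \<beta> * x)) * bessel_kernel q z (1 - x\<^sup>2)"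
  have "ennreal (sqrt pi) * bessel_kernel (q + 1/2) (z + \<beta>\<^sup>2) 1 = (\<integral>\<^sup>+x. ?f x \<partial>lborel)"
    using nn_integral_exp_bessel_kernel[OF q z, of "- \<beta>" 1] by simp
  also have "\<dots> = (\<integral>\<^sup>+x. ?f x * indicator {- cos 0..- cos pi} x \<partial>lborel)"
  proof (intro nn_integral_cong)
    fix x :: real
    have "1 - x\<^sup>2 \<le> 0" if "x \<notin> {-1..1}"
      using that abs_square_le_1[of x] by (auto simp: abs_le_iff)
    then show "?f x = ?f x * indicator {- cos 0..- cos pi} x"
      by (cases "x \<in> {-1..1}") (auto simp: bessel_kernel_nonpos)
  qed
  also have "\<dots> = (\<integral>\<^sup>+y. ?f (- cos y) * ennreal (sin y) * indicator {0..pi} y \<partial>lborel)"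
    by (rule nn_integral_substitution_aux)
      (auto intro!: derivative_eq_intros continuous_intros sin_ge_zero)
  also have "\<dots> = (\<integral>\<^sup>+y. ennreal (exp (\<beta> * cos y)) * bessel_kernel q z ((sin y)\<^sup>2) * ennreal (sin y)
             * indicator {0..pi} y \<partial>lborel)"
    by (simp add: sin_squared_eq)
  finally show ?thesis ..
qed

text \<open>The Bessel function of index -1/2 is elementary. Since
  \<open>sqrt pi = Gamma (1/2)\<close>, this is the exponential moment of a fair sign, the uniform
  law on the sphere of the real line.\<close>

lemma ennreal_cosh_eq_bessel_kernel:
  "ennreal (cosh y) = ennreal (sqrt pi) * bessel_kernel (1/2) (y\<^sup>2) 1"
proof -
  have eq: "y ^ (2 * i) / fact (2 * i) = sqrt pi * ((y\<^sup>2 / 4) ^ i / fact i * frac_kernel (1/2 + real i) 1)" for i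
  proof -
    have G: "Gamma (real i + 1/2) > 0" by (simp add: Gamma_real_pos)
    have "sqrt pi * ((y\<^sup>2 / 4) ^ i / fact i * frac_kernel (1/2 + real i) 1)
      = y ^ (2 * i) * (sqrt pi / (4 ^ i * fact i)) / Gamma (real i + 1/2)"
      by (simp add: frac_kernel_def power_mult power_divide add.commute)
    also have "\<dots> = y ^ (2 * i) / fact (2 * i)"
      unfolding Gamma_half_div_fact[symmetric] using G less_imp_neq[OF G, symmetric] by simp
    finally show ?thesis ..
  qed
  show ?thesis
    unfolding bessel_kernel_def suminf_ennreal_cosh[symmetric] eq
    by (simp only: ennreal_mult'[OF real_sqrt_ge_zero[OF pi_ge_zero]] ennreal_suminf_cmult)
qed

text \<open>The reflection \<open>y \<mapsto> 2 * pi - y\<close> folds the lower half of the circle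
  onto the upper one and flips the sign of \<gamma>. The two exponentials add up to a multiple of
  \<open>cosh (\<gamma> * sin y)\<close>, a Bessel series of index 1/2, and the polar angle formula
  with \<open>q = 1/2\<close> applies.\<close>

lemma nn_integral_azimuth:
  "(\<integral>\<^sup>+y. ennreal (exp (\<beta> * cos y + \<gamma> * sin y)) * indicator {0..2 * pi} y \<partial>lborel)
     = ennreal (2 * pi) * bessel_kernel 1 (\<beta>\<^sup>2 + \<gamma>\<^sup>2) 1"
proof -
  let ?e = "\<lambda>\<gamma> y. ennreal (exp (\<beta> * cos y + \<gamma> * sin y))"
  have "(\<integral>\<^sup>+y. ?e \<gamma> y * indicator {0..2 * pi} y \<partial>lborel)
      = (\<integral>\<^sup>+y. ?e \<gamma> y * indicator {0..pi} y + ?e \<gamma> y * indicator {pi<..2 * pi} y \<partial>lborel)"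
    by (intro nn_integral_cong) (auto simp: indicator_def)
  also have "\<dots> = (\<integral>\<^sup>+y. ?e \<gamma> y * indicator {0..pi} y \<partial>lborel)
      + (\<integral>\<^sup>+y. ?e \<gamma> y * indicator {pi<..2 * pi} y \<partial>lborel)"
    by (rule nn_integral_add) auto
  also have "(\<integral>\<^sup>+y. ?e \<gamma> y * indicator {pi<..2 * pi} y \<partial>lborel)
      = (\<integral>\<^sup>+y. ?e \<gamma> (2 * pi + -1 * y) * indicator {pi<..2 * pi} (2 * pi + -1 * y) \<partial>lborel)"
    by (subst nn_integral_real_affine[of _ "-1" "2 * pi"]) auto
  also have "\<dots> = (\<integral>\<^sup>+y. ?e (- \<gamma>) y * indicator {0..pi} y \<partial>lborel)"
    by (intro nn_integral_cong_AE AE_I[of _ _ "{pi}"])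
      (auto simp: indicator_def cos_diff sin_diff)
  also have "(\<integral>\<^sup>+y. ?e \<gamma> y * indicator {0..pi} y \<partial>lborel) + \<dots>
      = (\<integral>\<^sup>+y. ?e \<gamma> y * indicator {0..pi} y + ?e (- \<gamma>) y * indicator {0..pi} y \<partial>lborel)"
    by (rule nn_integral_add[symmetric]) auto
  also have "\<dots> = (\<integral>\<^sup>+y. ennreal (2 * sqrt pi) * (ennreal (exp (\<beta> * cos y))
      * bessel_kernel (1/2) (\<gamma>\<^sup>2) ((sin y)\<^sup>2) * ennreal (sin y) * indicator {0..pi} y) \<partial>lborel)"
  \<comment> \<open>At the two excluded points the sine is 0, so the right-hand side vanishes
    although the left-hand side does not. Elsewhere, scaling in index 1/2 yields
    \<open>1 / sin y\<close>, which cancels the Jacobian.\<close>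
  proof (intro nn_integral_cong_AE AE_I[of _ _ "{0, pi}"])
    show "{y \<in> space lborel. ?e \<gamma> y * indicator {0..pi} y + ?e (- \<gamma>) y * indicator {0..pi} y
      \<noteq> ennreal (2 * sqrt pi) * (ennreal (exp (\<beta> * cos y))
      * bessel_kernel (1/2) (\<gamma>\<^sup>2) ((sin y)\<^sup>2) * ennreal (sin y) * indicator {0..pi} y)} \<subseteq> {0, pi}"
    proof (safe, rule ccontr)
      fix y assume ne: "?e \<gamma> y * indicator {0..pi} y + ?e (- \<gamma>) y * indicator {0..pi} y
      \<noteq> ennreal (2 * sqrt pi) * (ennreal (exp (\<beta> * cos y))
      * bessel_kernel (1/2) (\<gamma>\<^sup>2) ((sin y)\<^sup>2) * ennreal (sin y) * indicator {0..pi} y)"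
        and y: "y \<notin> {}" "y \<noteq> 0" "y \<noteq> pi"
      have "y \<in> {0..pi}"
      proof (rule ccontr)
        assume "y \<notin> {0..pi}"
        then have "indicator {0..pi} y = (0 :: ennreal)" by (rule indicator_simps)
        with ne show False by simp
      qed
      with y have y': "0 < y" "y < pi" by auto
      then have s: "sin y > 0" by (rule sin_gt_zero)
      have pw: "(sin y)\<^sup>2 powr (1/2 - 1) = 1 / sin y"
      proof -
        have "(sin y)\<^sup>2 powr (1/2 - 1) = (sin y)\<^sup>2 powr (- (1/2))" by simp
        also have "\<dots> = 1 / sin y"
          unfolding powr_minus_divide using s by (simp add: powr_half_sqrt)
        finally show ?thesis .
      qed
      have e: "(sin y)\<^sup>2 * \<gamma>\<^sup>2 = (\<gamma> * sin y)\<^sup>2"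
        by (simp add: power_mult_distrib)
      have "bessel_kernel (1/2) (\<gamma>\<^sup>2) ((sin y)\<^sup>2)
          = ennreal (1 / sin y) * bessel_kernel (1/2) ((\<gamma> * sin y)\<^sup>2) 1"
        using bessel_kernel_scale[of "(sin y)\<^sup>2" "1/2" "\<gamma>\<^sup>2" 1] s
        unfolding pw e by simp
      moreover have "ennreal (1 / sin y) * ennreal (sin y) = 1"
        using s by (simp add: ennreal_mult'[symmetric])
      ultimately have *: "bessel_kernel (1/2) (\<gamma>\<^sup>2) ((sin y)\<^sup>2) * ennreal (sin y)
          = bessel_kernel (1/2) ((\<gamma> * sin y)\<^sup>2) 1"
        by (metis mult.assoc mult.commute mult_1)
      have "?e \<gamma> y + ?e (- \<gamma>) y = ennreal (2 * exp (\<beta> * cos y) * cosh (\<gamma> * sin y))"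
      proof -
        have "exp (\<beta> * cos y + \<gamma> * sin y) + exp (\<beta> * cos y + - \<gamma> * sin y)
            = 2 * exp (\<beta> * cos y) * cosh (\<gamma> * sin y)"
          by (simp only: exp_add cosh_field_def mult_minus_left) (simp add: distrib_left)
        then show ?thesis
          by (metis ennreal_plus exp_ge_zero)
      qed
      also have "\<dots> = 2 * ennreal (exp (\<beta> * cos y)) * ennreal (cosh (\<gamma> * sin y))"
        by (simp add: ennreal_mult')
      also have "\<dots> = ennreal (2 * sqrt pi) * (ennreal (exp (\<beta> * cos y))
          * (bessel_kernel (1/2) (\<gamma>\<^sup>2) ((sin y)\<^sup>2) * ennreal (sin y)))"
        unfolding * ennreal_cosh_eq_bessel_kernel by (simp add: ennreal_mult' mult_ac)
      finally show False using ne y' by (simp add: mult_ac)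
    qed
  qed (auto simp: emeasure_lborel_countable)
  also have "\<dots> = ennreal (2 * sqrt pi) * (ennreal (sqrt pi) * bessel_kernel (1/2 + 1/2) (\<gamma>\<^sup>2 + \<beta>\<^sup>2) 1)"
    by (subst nn_integral_cmult, measurable, subst nn_integral_polar_angle) auto
  also have "\<dots> = ennreal (2 * pi) * bessel_kernel 1 (\<beta>\<^sup>2 + \<gamma>\<^sup>2) 1"
  proof -
    have "ennreal (2 * sqrt pi) * ennreal (sqrt pi) = ennreal (2 * pi)"
      by (subst ennreal_mult'[symmetric]) auto
    then show ?thesis
      by (simp add: mult.assoc[symmetric] add.commute)
  qed
  finally show ?thesis .
qed

section \<open>Integration over all the angles\<close>

lemma power2_powr_half:
  assumes "x > 0"
  shows "(x\<^sup>2) powr (real n / 2) = x ^ n"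
proof -
  have "(x\<^sup>2) powr (real n / 2) = x powr (2 * (real n / 2))"
    unfolding powr_powr[symmetric] using assms by simp
  then show ?thesis using assms by (simp add: powr_realpow)
qed

lemma borel_measurable_bessel_kernel_compose [measurable (raw)]:
  assumes [measurable]: "f \<in> borel_measurable M" "g \<in> borel_measurable M"
  shows "(\<lambda>x. bessel_kernel b (f x) (g x)) \<in> borel_measurable M"
  unfolding bessel_kernel_def by measurable

lemma borel_measurable_PiM_component:
  fixes f :: "real \<Rightarrow> 'a :: topological_space"
  assumes "i < n" and f: "f \<in> borel_measurable borel"
  shows "(\<lambda>\<theta>. f (\<theta> i)) \<in> borel_measurable (PiM {..<n} (\<lambda>_. lborel))"
  using assms measurable_component_singleton[of i "{..<n}" "\<lambda>_. lborel :: real measure"]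
  by (intro measurable_compose[OF _ f]) simp

lemma borel_measurable_prod_sin [measurable (raw)]:
  fixes k n :: nat
  assumes "k \<le> n"
  shows "(\<lambda>\<theta>. \<Prod>i<k. sin (\<theta> i)) \<in> borel_measurable (PiM {..<n} (\<lambda>_. lborel :: real measure))"
  using assms by (intro borel_measurable_prod borel_measurable_PiM_component) auto

lemma borel_measurable_prod_sin_power [measurable (raw)]:
  fixes k n :: nat
  assumes "k \<le> n"
  shows "(\<lambda>\<theta>. \<Prod>i<k. ennreal (sin (\<theta> i) ^ e i) * indicator {0..pi} (\<theta> i))
     \<in> borel_measurable (PiM {..<n} (\<lambda>_. lborel :: real measure))"
  using assms by (intro borel_measurable_prod_ennreal borel_measurable_PiM_component[of _ n "\<lambda>x. ennreal (sin x ^ e _) * indicator {0..pi} x"])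
    auto

text \<open>The angles are integrated out starting from the last one, which avoids renumbering: each step
  raises the index of the Bessel series by one half and the exponents of the remaining sines
  by one.\<close>

lemma nn_integral_polar_angles:
  assumes z: "z \<ge> 0"
  shows "(\<integral>\<^sup>+\<theta>. ennreal (exp (\<Sum>k<m. b k * ((\<Prod>i<k. sin (\<theta> i :: real)) * cos (\<theta> k))))
             * bessel_kernel (real (r + 2) / 2) ((\<Prod>i<m. sin (\<theta> i))\<^sup>2 * z) 1
             * (\<Prod>i<m. ennreal (sin (\<theta> i) ^ (r + m - i)) * indicator {0..pi} (\<theta> i))
           \<partial>PiM {..<m} (\<lambda>_. lborel))
       = ennreal (sqrt pi ^ m) * bessel_kernel (real (r + 2 + m) / 2) (z + (\<Sum>k<m. (b k)\<^sup>2)) 1"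
  using z
proof (induction m arbitrary: r z)
  case 0
  then show ?case by (simp add: PiM_empty nn_integral_count_space_finite)
next
  case (Suc m)
  interpret product_sigma_finite "\<lambda>_. lborel :: real measure" by standard
  let ?P = "\<lambda>\<theta> k. \<Prod>i<k. sin (\<theta> i :: real)"
  let ?E = "\<lambda>\<theta>. ennreal (exp (\<Sum>k<m. b k * (?P \<theta> k * cos (\<theta> k))))"
  let ?w = "\<lambda>r m \<theta>. \<Prod>i<m. ennreal (sin (\<theta> i) ^ (r + m - i)) * indicator {0..pi} (\<theta> i)"
  let ?F = "\<lambda>\<theta>. ennreal (exp (\<Sum>k<Suc m. b k * (?P \<theta> k * cos (\<theta> k))))
             * bessel_kernel (real (r + 2) / 2) ((?P \<theta> (Suc m))\<^sup>2 * z) 1 * ?w r (Suc m) \<theta>"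
  have meas: "?F \<in> borel_measurable (PiM (insert m {..<m}) (\<lambda>_. lborel))"
    unfolding lessThan_Suc[of m, symmetric] by measurable
  \<comment> \<open>The last angle enters only the last exponent, the last sine of the product and
    the last weight. The other weights have exponents \<open>r + Suc m - i = Suc r + m - i\<close>,
    so the induction hypothesis is used at \<open>Suc r\<close>.\<close>
  have eqF: "?F (\<theta>(m := y)) = (?E \<theta> * ?w (Suc r) m \<theta>) *
      (ennreal (exp (b m * ?P \<theta> m * cos y)) *
       bessel_kernel (real (r + 2) / 2) ((?P \<theta> m * sin y)\<^sup>2 * z) 1 *
        (ennreal (sin y ^ Suc r) * indicator {0..pi} y))" for \<theta> y
  proof -
    have P: "?P (\<theta>(m := y)) k = ?P \<theta> k" if "k \<le> m" for k
      using that by (intro prod.cong) auto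
    have w0: "(\<Prod>i<m. ennreal (sin ((\<theta>(m := y)) i) ^ (r + Suc m - i)) * indicator {0..pi} ((\<theta>(m := y)) i))
        = ?w (Suc r) m \<theta>"
      by (intro prod.cong) auto
    have e: "r + Suc m - m = Suc r" by simp
    have w: "?w r (Suc m) (\<theta>(m := y)) = ?w (Suc r) m \<theta> * (ennreal (sin y ^ Suc r) * indicator {0..pi} y)"
      unfolding prod.lessThan_Suc w0 fun_upd_same e ..
    have "(\<Sum>k<m. b k * (?P (\<theta>(m := y)) k * cos ((\<theta>(m := y)) k))) = (\<Sum>k<m. b k * (?P \<theta> k * cos (\<theta> k)))"
      by (intro sum.cong) (auto simp: P)
    then have S: "(\<Sum>k<Suc m. b k * (?P (\<theta>(m := y)) k * cos ((\<theta>(m := y)) k)))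
        = (\<Sum>k<m. b k * (?P \<theta> k * cos (\<theta> k))) + b m * ?P \<theta> m * cos y"
      by (simp only: sum.lessThan_Suc fun_upd_same P order_refl mult.assoc)
    have PS: "?P (\<theta>(m := y)) (Suc m) = ?P \<theta> m * sin y"
      by (simp only: prod.lessThan_Suc fun_upd_same P order_refl)
    show ?thesis
      unfolding w S PS exp_add ennreal_mult'[OF exp_ge_zero] by (simp only: mult_ac)
  qed
  \<comment> \<open>Of the \<open>Suc r\<close> powers of \<open>sin y\<close>, one is the Jacobian.
    The other \<open>r\<close> are what scaling the argument from 1 to \<open>sin^2 y\<close> costs
    at index \<open>(r + 2) / 2\<close>.\<close>
  have inner: "(\<integral>\<^sup>+y. (ennreal (exp (b m * p * cos y)) *
       bessel_kernel (real (r + 2) / 2) ((p * sin y)\<^sup>2 * z) 1 *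
        (ennreal (sin y ^ Suc r) * indicator {0..pi} y)) \<partial>lborel)
      = ennreal (sqrt pi) * bessel_kernel (real (Suc r + 2) / 2) (p\<^sup>2 * (z + (b m)\<^sup>2)) 1" for p
  proof -
    have "(\<integral>\<^sup>+y. (ennreal (exp (b m * p * cos y)) *
       bessel_kernel (real (r + 2) / 2) ((p * sin y)\<^sup>2 * z) 1 *
        (ennreal (sin y ^ Suc r) * indicator {0..pi} y)) \<partial>lborel)
      = (\<integral>\<^sup>+y. (ennreal (exp (b m * p * cos y)) *
           bessel_kernel (real (r + 2) / 2) (p\<^sup>2 * z) ((sin y)\<^sup>2) * ennreal (sin y) * indicator {0..pi} y) \<partial>lborel)"
    proof (intro nn_integral_cong_AE)
      have "AE y in lborel. y \<notin> {0, pi :: real}"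
        by (intro AE_not_in countable_imp_null_set_lborel) auto
      then show "AE y in lborel. (ennreal (exp (b m * p * cos y)) *
           bessel_kernel (real (r + 2) / 2) ((p * sin y)\<^sup>2 * z) 1 *
            (ennreal (sin y ^ Suc r) * indicator {0..pi} y))
          = (ennreal (exp (b m * p * cos y)) *
           bessel_kernel (real (r + 2) / 2) (p\<^sup>2 * z) ((sin y)\<^sup>2) * ennreal (sin y) * indicator {0..pi} y)"
      proof eventually_elim
        case (elim y)
        show ?case
        proof (cases "y \<in> {0..pi}")
          case True
          with elim have s: "sin y > 0" by (intro sin_gt_zero) auto
          then have pw: "(sin y)\<^sup>2 powr (real (r + 2) / 2 - 1) = sin y ^ r"
            using power2_powr_half[of "sin y" r] by (simp add: add_divide_distrib)
          have e: "(sin y)\<^sup>2 * (p\<^sup>2 * z) = (p * sin y)\<^sup>2 * z"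
            by (simp add: power_mult_distrib)
          have "bessel_kernel (real (r + 2) / 2) (p\<^sup>2 * z) ((sin y)\<^sup>2)
              = ennreal (sin y ^ r) * bessel_kernel (real (r + 2) / 2) ((p * sin y)\<^sup>2 * z) 1"
            using bessel_kernel_scale[of "(sin y)\<^sup>2" "real (r + 2) / 2" "p\<^sup>2 * z" 1] Suc.prems s
            unfolding pw e by simp
          moreover have "ennreal (sin y ^ Suc r) = ennreal (sin y) * ennreal (sin y ^ r)"
            using s by (simp add: ennreal_mult')
          ultimately show ?thesis by (simp only: mult_ac)
        qed simp
      qed
    qed
    also have "\<dots> = ennreal (sqrt pi) * bessel_kernel (real (r + 2) / 2 + 1/2) (p\<^sup>2 * z + (b m * p)\<^sup>2) 1"
      using Suc.prems by (intro nn_integral_polar_angle) auto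
    finally show ?thesis by (simp add: power_mult_distrib algebra_simps add_divide_distrib)
  qed
  have "(\<integral>\<^sup>+\<theta>. ?F \<theta> \<partial>PiM {..<Suc m} (\<lambda>_. lborel))
      = (\<integral>\<^sup>+\<theta>. (\<integral>\<^sup>+y. ?F (\<theta>(m := y)) \<partial>lborel) \<partial>PiM {..<m} (\<lambda>_. lborel))"
    unfolding lessThan_Suc[of m]
    by (rule product_nn_integral_insert[OF _ _ meas[unfolded lessThan_Suc[of m]]]) auto
  also have "\<dots> = (\<integral>\<^sup>+\<theta>. ennreal (sqrt pi) * (?E \<theta> *
      bessel_kernel (real (Suc r + 2) / 2) ((?P \<theta> m)\<^sup>2 * (z + (b m)\<^sup>2)) 1 * ?w (Suc r) m \<theta>) \<partial>PiM {..<m} (\<lambda>_. lborel))"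
    unfolding eqF by (intro nn_integral_cong, subst nn_integral_cmult, measurable, subst inner) (simp add: mult_ac)
  also have "\<dots> = ennreal (sqrt pi) * (\<integral>\<^sup>+\<theta>. (?E \<theta> *
      bessel_kernel (real (Suc r + 2) / 2) ((?P \<theta> m)\<^sup>2 * (z + (b m)\<^sup>2)) 1 * ?w (Suc r) m \<theta>) \<partial>PiM {..<m} (\<lambda>_. lborel))"
    by (rule nn_integral_cmult) measurable
  also have "\<dots> = ennreal (sqrt pi ^ Suc m) *
      bessel_kernel (real (r + 2 + Suc m) / 2) (z + (\<Sum>k<Suc m. (b k)\<^sup>2)) 1"
    using Suc.prems by (subst Suc.IH) (auto simp: ennreal_mult' mult_ac add_ac)
  finally show ?case .
qed

text \<open>The last two coordinates share the full product of polar sines and are the only ones to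
  contain the azimuth. Isolating them leaves an azimuthal integral whose coefficients are scaled by
  that product.\<close>

lemma inner_hyperspherical:
  fixes \<beta> :: "real ^ 'd"
  assumes d: "CARD('d) = m + 2"
  defines "b \<equiv> \<lambda>k. \<beta> $ from_nat_into UNIV k"
  shows "\<beta> \<bullet> hyperspherical \<theta> = (\<Sum>k<m. b k * ((\<Prod>i<k. sin (\<theta> i :: real)) * cos (\<theta> k)))
      + (\<Prod>i<m. sin (\<theta> i)) * (b m * cos (\<theta> m) + b (Suc m) * sin (\<theta> m))"
    and "(norm \<beta>)\<^sup>2 = (\<Sum>k<m. (b k)\<^sup>2) + (b m)\<^sup>2 + (b (Suc m))\<^sup>2"
proof -
  have bij: "bij_betw (to_nat_on (UNIV :: 'd set)) UNIV {..<m + 2}"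
    using to_nat_on_finite[of "UNIV :: 'd set"] d by simp
  have inv: "from_nat_into UNIV (to_nat_on (UNIV :: 'd set) i) = i" for i :: 'd
    by (rule from_nat_into_to_nat_on) (auto simp: countable_finite)
  have sum: "(\<Sum>i\<in>UNIV. h (\<beta> $ i) (to_nat_on (UNIV :: 'd set) i)) = (\<Sum>k<m + 2. h (b k) k)"
    for h :: "real \<Rightarrow> nat \<Rightarrow> real"
    using sum.reindex_bij_betw[OF bij, of "\<lambda>k. h (b k) k"] by (simp add: b_def inv)
  have "\<beta> \<bullet> hyperspherical \<theta> = (\<Sum>k<m + 2. b k * hyperspherical_coord (m + 2) \<theta> k)"
    using sum[of "\<lambda>x k. x * hyperspherical_coord (m + 2) \<theta> k"]
    by (simp add: inner_vec_def hyperspherical_def d)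
  also have "\<dots> = (\<Sum>k<m. b k * ((\<Prod>i<k. sin (\<theta> i :: real)) * cos (\<theta> k)))
      + (\<Prod>i<m. sin (\<theta> i)) * (b m * cos (\<theta> m) + b (Suc m) * sin (\<theta> m))"
    by (simp add: hyperspherical_coord_def algebra_simps)
  finally show "\<beta> \<bullet> hyperspherical \<theta> = (\<Sum>k<m. b k * ((\<Prod>i<k. sin (\<theta> i :: real)) * cos (\<theta> k)))
      + (\<Prod>i<m. sin (\<theta> i)) * (b m * cos (\<theta> m) + b (Suc m) * sin (\<theta> m))" .
  show "(norm \<beta>)\<^sup>2 = (\<Sum>k<m. (b k)\<^sup>2) + (b m)\<^sup>2 + (b (Suc m))\<^sup>2"
    using sum[of "\<lambda>x k. x\<^sup>2"]
    unfolding power2_norm_eq_inner inner_vec_def by (simp add: power2_eq_square)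
qed

text \<open>The azimuth is integrated first and gives index 1. The \<open>m = d - 2\<close> polar
  angles then raise the index to \<open>d / 2\<close>, while the squared coefficients accumulate to
  the squared norm of \<beta>.\<close>

lemma nn_integral_exp_uniform_sphere:
  fixes \<beta> :: "real ^ 'd"
  assumes d: "CARD('d) \<ge> 2"
  shows "(\<integral>\<^sup>+v. ennreal (exp (\<beta> \<bullet> v)) \<partial>uniform_sphere)
       = ennreal (Gamma (real CARD('d) / 2)) * bessel_kernel (real CARD('d) / 2) ((norm \<beta>)\<^sup>2) 1"
proof -
  obtain m where m: "CARD('d) = m + 2"
    using d by (metis add.commute le_Suc_ex)
  define b where "b = (\<lambda>k. \<beta> $ from_nat_into UNIV k)"
  interpret product_sigma_finite "\<lambda>_. lborel :: real measure" by standard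
  let ?P = "\<lambda>\<theta> k. \<Prod>i<k. sin (\<theta> i :: real)"
  let ?E = "\<lambda>\<theta>. ennreal (exp (\<Sum>k<m. b k * (?P \<theta> k * cos (\<theta> k))))"
  let ?w = "\<lambda>\<theta>. \<Prod>i<m. ennreal (sin (\<theta> i) ^ (0 + m - i)) * indicator {0..pi} (\<theta> i)"
  let ?C = "Gamma (real CARD('d) / 2) / (2 * pi powr (real CARD('d) / 2))"
  have C: "?C \<ge> 0" by (simp add: Gamma_real_pos less_imp_le)
  have norm: "(norm \<beta>)\<^sup>2 = (\<Sum>k<m. (b k)\<^sup>2) + (b m)\<^sup>2 + (b (Suc m))\<^sup>2"
    unfolding b_def by (rule inner_hyperspherical(2)[OF m])
  have inner: "ennreal (exp (\<beta> \<bullet> hyperspherical \<theta>)) = ?E \<theta> *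
      ennreal (exp ((?P \<theta> m * b m) * cos (\<theta> m) + (?P \<theta> m * b (Suc m)) * sin (\<theta> m)))" for \<theta>
    unfolding inner_hyperspherical(1)[OF m] b_def
    by (simp add: exp_add ennreal_mult' distrib_left mult.assoc)
  have I: "{..<CARD('d) - 1} = {..<Suc m}" using m by simp
  have [measurable]: "hyperspherical_density CARD('d) \<in> borel_measurable (PiM {..<Suc m} (\<lambda>_. lborel))"
    using measurable_hyperspherical_density[OF d] unfolding I .
  have [measurable]: "(hyperspherical :: _ \<Rightarrow> real ^ 'd) \<in> borel_measurable (PiM {..<Suc m} (\<lambda>_. lborel))"
    using measurable_hyperspherical[where 'd = 'd] unfolding I .
  \<comment> \<open>With the box conditions expressed by indicators, the density becomes a product
    of functions of single angles, as iterated integration needs.\<close>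
  have dens: "ennreal (hyperspherical_density CARD('d) \<theta>)
      = ennreal ?C * ?w \<theta> * indicator {0..2 * pi} (\<theta> m)" for \<theta>
  proof (cases "(\<forall>i<m. 0 \<le> \<theta> i \<and> \<theta> i \<le> pi) \<and> 0 \<le> \<theta> m \<and> \<theta> m \<le> 2 * pi")
    case True
    then have "?w \<theta> = ennreal (\<Prod>i<m. sin (\<theta> i) ^ (m - i))"
      by (subst prod_ennreal[symmetric]) (auto intro!: prod.cong zero_le_power sin_ge_zero)
    moreover have "hyperspherical_density CARD('d) \<theta> = ?C * (\<Prod>i<m. sin (\<theta> i) ^ (m - i))"
      using True m by (simp add: hyperspherical_density_def)
    ultimately show ?thesis
      using True ennreal_mult'[OF C] by simp
  next
    case False
    then have "\<theta> m \<notin> {0..2 * pi} \<or> (\<exists>i<m. \<theta> i \<notin> {0..pi})" by auto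
    then have "?w \<theta> * indicator {0..2 * pi} (\<theta> m) = 0"
    proof
      assume "\<exists>i<m. \<theta> i \<notin> {0..pi}"
      then have "?w \<theta> = 0" by (intro prod_zero) (auto intro!: bexI)
      then show ?thesis by simp
    qed simp
    then show ?thesis
      using False m by (auto simp: hyperspherical_density_def mult.assoc)
  qed
  have "(\<integral>\<^sup>+v. ennreal (exp (\<beta> \<bullet> v)) \<partial>uniform_sphere)
      = (\<integral>\<^sup>+\<theta>. ennreal (hyperspherical_density CARD('d) \<theta>) * ennreal (exp (\<beta> \<bullet> hyperspherical \<theta>))
           \<partial>PiM {..<Suc m} (\<lambda>_. lborel))"
    unfolding uniform_sphere_def I by (subst nn_integral_distr, measurable, subst nn_integral_density) auto
  also have "\<dots> = (\<integral>\<^sup>+\<theta>. ennreal ?C * ((?E \<theta> * ?w \<theta>) * (ennreal (exp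
        ((?P \<theta> m * b m) * cos (\<theta> m) + (?P \<theta> m * b (Suc m)) * sin (\<theta> m))) * indicator {0..2 * pi} (\<theta> m)))
           \<partial>PiM {..<Suc m} (\<lambda>_. lborel))"
    by (intro nn_integral_cong)
      (simp only: dens inner mult_ac)
  also have "{..<Suc m} = insert m {..<m}" by (rule lessThan_Suc)
  also have "(\<integral>\<^sup>+\<theta>. ennreal ?C * ((?E \<theta> * ?w \<theta>) * (ennreal (exp
        ((?P \<theta> m * b m) * cos (\<theta> m) + (?P \<theta> m * b (Suc m)) * sin (\<theta> m))) * indicator {0..2 * pi} (\<theta> m)))
           \<partial>PiM (insert m {..<m}) (\<lambda>_. lborel))
    = (\<integral>\<^sup>+\<theta>. (\<integral>\<^sup>+y. ennreal ?C * ((?E \<theta> * ?w \<theta>) * (ennreal (exp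
        ((?P \<theta> m * b m) * cos y + (?P \<theta> m * b (Suc m)) * sin y)) * indicator {0..2 * pi} y)) \<partial>lborel)
           \<partial>PiM {..<m} (\<lambda>_. lborel))" (is "integral\<^sup>N _ ?F = _")
  proof (subst product_nn_integral_insert)
    show "?F \<in> borel_measurable (PiM (insert m {..<m}) (\<lambda>_. lborel))"
      unfolding lessThan_Suc[symmetric] by measurable
    have P: "?P (\<theta>(m := y)) k = ?P \<theta> k" if "k \<le> m" for k \<theta> y
      using that by (intro prod.cong) auto
    have E: "?E (\<theta>(m := y)) = ?E \<theta>" for \<theta> y
      by (intro arg_cong[where f = "\<lambda>x. ennreal (exp x)"] sum.cong) (auto simp: P)
    have w: "?w (\<theta>(m := y)) = ?w \<theta>" for \<theta> y
      by (intro prod.cong) auto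
    show "(\<integral>\<^sup>+\<theta>. (\<integral>\<^sup>+y. ?F (\<theta>(m := y)) \<partial>lborel) \<partial>PiM {..<m} (\<lambda>_. lborel))
      = (\<integral>\<^sup>+\<theta>. (\<integral>\<^sup>+y. ennreal ?C * ((?E \<theta> * ?w \<theta>) * (ennreal (exp
        ((?P \<theta> m * b m) * cos y + (?P \<theta> m * b (Suc m)) * sin y)) * indicator {0..2 * pi} y)) \<partial>lborel)
           \<partial>PiM {..<m} (\<lambda>_. lborel))"
      unfolding E w by (simp only: P order_refl fun_upd_same)
  qed auto
  \<comment> \<open>The index 1 left by the azimuth is written \<open>real (0 + 2) / 2\<close> to
    match the polar integral at \<open>r = 0\<close>.\<close>
  also have "\<dots> = (\<integral>\<^sup>+\<theta>. ennreal (?C * (2 * pi)) *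
      (?E \<theta> * bessel_kernel (real (0 + 2) / 2) ((?P \<theta> m)\<^sup>2 * ((b m)\<^sup>2 + (b (Suc m))\<^sup>2)) 1 * ?w \<theta>)
           \<partial>PiM {..<m} (\<lambda>_. lborel))"
  proof (intro nn_integral_cong)
    fix \<theta> :: "nat \<Rightarrow> real"
    have e: "(?P \<theta> m * b m)\<^sup>2 + (?P \<theta> m * b (Suc m))\<^sup>2 = (?P \<theta> m)\<^sup>2 * ((b m)\<^sup>2 + (b (Suc m))\<^sup>2)"
      by (simp add: power_mult_distrib distrib_left)
    have "(\<integral>\<^sup>+y. ennreal ?C * ((?E \<theta> * ?w \<theta>) * (ennreal (exp
        ((?P \<theta> m * b m) * cos y + (?P \<theta> m * b (Suc m)) * sin y)) * indicator {0..2 * pi} y)) \<partial>lborel)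
      = ennreal ?C * ((?E \<theta> * ?w \<theta>) *
          (ennreal (2 * pi) * bessel_kernel (real (0 + 2) / 2) ((?P \<theta> m)\<^sup>2 * ((b m)\<^sup>2 + (b (Suc m))\<^sup>2)) 1))"
      by (subst nn_integral_cmult, measurable, subst nn_integral_cmult, measurable,
        subst nn_integral_azimuth) (simp only: e, simp)
    then show "(\<integral>\<^sup>+y. ennreal ?C * ((?E \<theta> * ?w \<theta>) * (ennreal (exp
        ((?P \<theta> m * b m) * cos y + (?P \<theta> m * b (Suc m)) * sin y)) * indicator {0..2 * pi} y)) \<partial>lborel)
      = ennreal (?C * (2 * pi)) *
      (?E \<theta> * bessel_kernel (real (0 + 2) / 2) ((?P \<theta> m)\<^sup>2 * ((b m)\<^sup>2 + (b (Suc m))\<^sup>2)) 1 * ?w \<theta>)"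
      unfolding ennreal_mult'[OF C] by (simp only: mult_ac)
  qed
  also have "\<dots> = ennreal (?C * (2 * pi)) * (ennreal (sqrt pi ^ m) *
      bessel_kernel (real (0 + 2 + m) / 2) (((b m)\<^sup>2 + (b (Suc m))\<^sup>2) + (\<Sum>k<m. (b k)\<^sup>2)) 1)"
    by (subst nn_integral_cmult, measurable, subst nn_integral_polar_angles) auto
  also have "\<dots> = ennreal (?C * (2 * pi) * sqrt pi ^ m) * bessel_kernel (real CARD('d) / 2) ((norm \<beta>)\<^sup>2) 1"
    using C m by (simp add: norm mult.assoc[symmetric] ennreal_mult'[symmetric] add_ac)
  \<comment> \<open>With \<open>d = m + 2\<close>, the factor \<open>2 * pi\<close> from the azimuth
    and \<open>sqrt pi\<close> from each polar angle multiply to \<open>2 * pi powr (d / 2)\<close>,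
    the denominator of \<open>?C\<close>.\<close>
  also have "?C * (2 * pi) * sqrt pi ^ m = Gamma (real CARD('d) / 2)"
  proof -
    have "pi powr (real CARD('d) / 2) = pi * sqrt pi ^ m"
      using m power2_powr_half[of "sqrt pi" m] by (simp add: add_divide_distrib powr_add)
    then show ?thesis by simp
  qed
  finally show ?thesis .
qed

text \<open>The squares telescope: the first \<open>k\<close> of them plus the square of the running
  sine product always give 1. This holds for arbitrary angles, so the density does not
  enter.\<close>

lemma norm_hyperspherical:
  assumes d: "CARD('d) \<ge> 2"
  shows "norm (hyperspherical \<theta> :: real ^ 'd) = 1"
proof -
  obtain m where m: "CARD('d) = m + 2"
    using d by (metis add.commute le_Suc_ex)
  let ?P = "\<lambda>k. \<Prod>i<k. sin (\<theta> i)"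
  have bij: "bij_betw (to_nat_on (UNIV :: 'd set)) UNIV {..<m + 2}"
    using to_nat_on_finite[of "UNIV :: 'd set"] m by simp
  have part: "(\<Sum>i<k. (?P i * cos (\<theta> i))\<^sup>2) + (?P k)\<^sup>2 = 1" for k
    by (induction k) (simp_all add: power_mult_distrib cos_squared_eq algebra_simps)
  have "(norm (hyperspherical \<theta> :: real ^ 'd))\<^sup>2
      = (\<Sum>i\<in>UNIV. (hyperspherical_coord (m + 2) \<theta> (to_nat_on (UNIV :: 'd set) i))\<^sup>2)"
    unfolding power2_norm_eq_inner inner_vec_def
    by (simp add: hyperspherical_def m power2_eq_square)
  also have "\<dots> = (\<Sum>k<m + 2. (hyperspherical_coord (m + 2) \<theta> k)\<^sup>2)"
    by (rule sum.reindex_bij_betw[OF bij])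
  also have "\<dots> = (\<Sum>i<Suc m. (?P i * cos (\<theta> i))\<^sup>2) + (?P (Suc m))\<^sup>2"
    by (simp add: hyperspherical_coord_def)
  also have "\<dots> = 1" by (rule part)
  finally show ?thesis by (intro power2_eq_imp_eq[of _ 1]) auto
qed

lemma AE_uniform_sphere_norm:
  assumes "CARD('d) \<ge> 2"
  shows "AE v in (uniform_sphere :: (real ^ 'd) measure). norm v = 1"
  unfolding uniform_sphere_def using measurable_hyperspherical[where 'd = 'd]
  by (subst AE_distr_iff) (auto simp: norm_hyperspherical[OF assms])

section \<open>Uniqueness by exponential moments\<close>

text \<open>The linear span of the exponentials, generated inductively so that statements linear in
  the function follow by rule induction.\<close>

inductive exponential_sum :: "('a :: real_inner \<Rightarrow> real) \<Rightarrow> bool" where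
  exp: "exponential_sum (\<lambda>x. c * exp (\<alpha> \<bullet> x))"
| add: "exponential_sum f \<Longrightarrow> exponential_sum g \<Longrightarrow> exponential_sum (\<lambda>x. f x + g x)"

lemma exponential_sum_mult:
  assumes "exponential_sum f" "exponential_sum g"
  shows "exponential_sum (\<lambda>x. f x * g x)"
  using assms(1)
proof induction
  case (exp c \<alpha>)
  from assms(2) show ?case
  proof induction
    case (exp c' \<alpha>')
    have "(\<lambda>x. c * exp (\<alpha> \<bullet> x) * (c' * exp (\<alpha>' \<bullet> x))) = (\<lambda>x. (c * c') * exp ((\<alpha> + \<alpha>') \<bullet> x))"
      by (simp add: inner_add_left exp_add mult_ac)
    then show ?case by (simp only: exponential_sum.exp)
  next
    case (add f g)
    then show ?case by (simp add: distrib_left exponential_sum.add)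
  qed
next
  case (add f f')
  then show ?case by (simp add: distrib_right exponential_sum.add)
qed

lemma continuous_on_exponential_sum: "exponential_sum f \<Longrightarrow> continuous_on S f"
  by (induction rule: exponential_sum.induct) (auto intro!: continuous_intros)

lemma exponential_sum_approximation:
  fixes f :: "'a :: euclidean_space \<Rightarrow> real"
  assumes "compact S" "continuous_on S f" "e > 0"
  obtains g where "exponential_sum g" "\<And>x. x \<in> S \<Longrightarrow> \<bar>f x - g x\<bar> < e"
proof -
  have "\<exists>g. exponential_sum g \<and> (\<forall>x\<in>S. \<bar>f x - g x\<bar> < e)"
  proof (rule Stone_Weierstrass_HOL[OF assms(1) _ _ _ _ _ assms(2,3)])
    show "exponential_sum (\<lambda>x :: 'a. c)" for c
      using exponential_sum.exp[of c "0 :: 'a"] by simp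
    show "\<exists>g. exponential_sum g \<and> g x \<noteq> g y" if "x \<in> S \<and> y \<in> S \<and> x \<noteq> y" for x y :: 'a
    proof (intro exI conjI)
      \<comment> \<open>The exponent \<open>x - y\<close> separates \<open>x\<close> from
        \<open>y\<close>: its inner products with them differ by the squared distance.\<close>
      show "exponential_sum (\<lambda>v. 1 * exp ((x - y) \<bullet> v))" by (rule exponential_sum.exp)
      have "(x - y) \<bullet> x - (x - y) \<bullet> y = (norm (x - y))\<^sup>2"
        by (simp add: power2_norm_eq_inner inner_diff_right)
      with that show "1 * exp ((x - y) \<bullet> x) \<noteq> 1 * exp ((x - y) \<bullet> y)" by auto
    qed
  qed (auto intro: continuous_on_exponential_sum exponential_sum.add exponential_sum_mult)
  with that show thesis by auto
qed

text \<open>Off a closed set the distance is positive, so the truncated functions are eventually 0.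
  Nonemptiness matters because \<open>infdist x {} = 0\<close> by convention.\<close>

lemma tendsto_indicator_closed:
  assumes "closed C" "C \<noteq> {}"
  shows "(\<lambda>n. max 0 (1 - real n * infdist x C)) \<longlonglongrightarrow> indicator C x"
proof (cases "x \<in> C")
  case True
  then show ?thesis by simp
next
  case False
  with assms have d: "infdist x C > 0"
    by (simp add: infdist_pos_not_in_closed)
  obtain N where N: "1 < real N * infdist x C"
    using reals_Archimedean3[OF d] by blast
  have "eventually (\<lambda>n. max 0 (1 - real n * infdist x C) = 0) sequentially"
  proof (intro eventually_sequentiallyI[of N])
    fix n assume "N \<le> n"
    then have "real N * infdist x C \<le> real n * infdist x C"
      using d by (intro mult_right_mono) auto
    with N show "max 0 (1 - real n * infdist x C) = 0" by simp
  qed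
  then show ?thesis
    using False by (simp add: tendsto_eventually)
qed

text \<open>Equality of integrals passes from exponentials to their span, then to continuous
  functions by uniform approximation on the ball carrying both measures, then to indicators of
  closed sets by dominated convergence. The closed sets form an intersection-stable generator of the
  Borel sets.\<close>

lemma measure_eqI_exponential_moments:
  fixes M N :: "'a :: euclidean_space measure"
  assumes fin: "finite_measure M" "finite_measure N"
    and sets: "sets M = sets borel" "sets N = sets borel"
    and bdd: "AE x in M. norm x \<le> R" "AE x in N. norm x \<le> R"
    and eq: "\<And>\<alpha>. (\<integral>\<^sup>+x. ennreal (exp (\<alpha> \<bullet> x)) \<partial>M) = (\<integral>\<^sup>+x. ennreal (exp (\<alpha> \<bullet> x)) \<partial>N)"
  shows "M = N"
proof -
  interpret M: finite_measure M by fact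
  interpret N: finite_measure N by fact
  note [measurable_cong] = sets
  have integrable: "integrable M f" "integrable N f" if f: "continuous_on UNIV f" for f :: "'a \<Rightarrow> real"
  proof -
    have "compact (f ` cball 0 R)"
      by (intro compact_continuous_image continuous_on_subset[OF f]) auto
    then obtain B where B: "\<And>x. norm x \<le> R \<Longrightarrow> \<bar>f x\<bar> \<le> B"
      by (force dest!: compact_imp_bounded simp: bounded_iff)
    have [measurable]: "f \<in> borel_measurable borel"
      using f by (rule borel_measurable_continuous_onI)
    show "integrable M f"
      using bdd(1) by (intro M.integrable_const_bound[of _ B]) (auto elim!: eventually_mono dest!: B)
    show "integrable N f"
      using bdd(2) by (intro N.integrable_const_bound[of _ B]) (auto elim!: eventually_mono dest!: B)
  qed
  have eq_sum: "integral\<^sup>L M g = integral\<^sup>L N g" if "exponential_sum g" for g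
    using that
  proof induction
    case (exp c \<alpha>)
    have "(\<integral>x. exp (\<alpha> \<bullet> x) \<partial>M) = (\<integral>x. exp (\<alpha> \<bullet> x) \<partial>N)"
      by (simp add: integral_eq_nn_integral eq)
    then show ?case by simp
  next
    case (add f g)
    then show ?case
      by (simp add: integrable continuous_on_exponential_sum)
  qed
  have eq_cont: "integral\<^sup>L M f = integral\<^sup>L N f" if f: "continuous_on UNIV f" for f :: "'a \<Rightarrow> real"
  proof -
    define K where "K = measure M (space M) + measure N (space N)"
    have bound: "\<bar>integral\<^sup>L M f - integral\<^sup>L N f\<bar> \<le> e * K" if "e > 0" for e
    proof -
      obtain g where g: "exponential_sum g" "\<And>x. x \<in> cball 0 R \<Longrightarrow> \<bar>f x - g x\<bar> < e"
        using exponential_sum_approximation[of "cball 0 R" f e] continuous_on_subset[OF f] \<open>e > 0\<close>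
        by (metis compact_cball subset_UNIV)
      have gc: "continuous_on UNIV g" by (rule continuous_on_exponential_sum[OF g(1)])
      have fg: "integrable M (\<lambda>x. f x - g x)" "integrable N (\<lambda>x. f x - g x)"
        using integrable[OF f] integrable[OF gc] by auto
      have "\<bar>integral\<^sup>L M f - integral\<^sup>L M g\<bar> \<le> (\<integral>x. \<bar>f x - g x\<bar> \<partial>M)"
        using integral_abs_bound[of M "\<lambda>x. f x - g x"] integrable[OF f] integrable[OF gc] by simp
      also have "\<dots> \<le> (\<integral>x. e \<partial>M)"
        using fg bdd(1) by (intro integral_mono_AE) (auto elim!: eventually_mono dest!: g(2)[unfolded mem_cball_0, THEN less_imp_le])
      finally have 1: "\<bar>integral\<^sup>L M f - integral\<^sup>L M g\<bar> \<le> e * measure M (space M)"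
        by (simp add: mult.commute)
      have "\<bar>integral\<^sup>L N f - integral\<^sup>L N g\<bar> \<le> (\<integral>x. \<bar>f x - g x\<bar> \<partial>N)"
        using integral_abs_bound[of N "\<lambda>x. f x - g x"] integrable[OF f] integrable[OF gc] by simp
      also have "\<dots> \<le> (\<integral>x. e \<partial>N)"
        using fg bdd(2) by (intro integral_mono_AE) (auto elim!: eventually_mono dest!: g(2)[unfolded mem_cball_0, THEN less_imp_le])
      finally have 2: "\<bar>integral\<^sup>L N f - integral\<^sup>L N g\<bar> \<le> e * measure N (space N)"
        by (simp add: mult.commute)
      from 1 2 eq_sum[OF g(1)] show ?thesis by (simp add: distrib_left K_def)
    qed
    have K: "K \<ge> 0" by (simp add: K_def)
    have "\<bar>integral\<^sup>L M f - integral\<^sup>L N f\<bar> \<le> 0 + e" if "e > 0" for e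
    proof -
      \<comment> \<open>Dividing by \<open>K + 1\<close> instead of \<open>K\<close> covers the case
        in which both measures are zero.\<close>
      have "\<bar>integral\<^sup>L M f - integral\<^sup>L N f\<bar> \<le> e / (K + 1) * K"
        using that K by (intro bound divide_pos_pos) linarith+
      also have "\<dots> \<le> e" using that K by (simp add: field_simps)
      finally show ?thesis by simp
    qed
    then have "\<bar>integral\<^sup>L M f - integral\<^sup>L N f\<bar> \<le> 0" by (rule field_le_epsilon)
    then show ?thesis by simp
  qed
  have closed: "emeasure M C = emeasure N C" if C: "closed C" for C
  proof (cases "C = {}")
    case False
    let ?h = "\<lambda>n x. max 0 (1 - real n * infdist x C)"
    have hc: "continuous_on UNIV (?h n)" for n
      by (intro continuous_intros continuous_on_infdist)
    have [measurable]: "?h n \<in> borel_measurable borel" for n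
      using hc by (rule borel_measurable_continuous_onI)
    have [measurable]: "C \<in> sets borel" using C by simp
    have h1: "norm (?h n x) \<le> 1" for n x
      using infdist_nonneg[of x C] by (simp add: mult_nonneg_nonneg)
    have "(\<lambda>n. integral\<^sup>L M (?h n)) \<longlonglongrightarrow> integral\<^sup>L M (indicator C)"
      using C False h1 by (intro integral_dominated_convergence[where w = "\<lambda>_. 1"])
        (auto intro!: tendsto_indicator_closed)
    moreover have "(\<lambda>n. integral\<^sup>L N (?h n)) \<longlonglongrightarrow> integral\<^sup>L N (indicator C)"
      using C False h1 by (intro integral_dominated_convergence[where w = "\<lambda>_. 1"])
        (auto intro!: tendsto_indicator_closed)
    ultimately have "integral\<^sup>L M (indicator C) = integral\<^sup>L N (indicator C :: 'a \<Rightarrow> real)"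
      unfolding eq_cont[OF hc] by (rule LIMSEQ_unique)
    then have "measure M C = measure N C"
      using sets[THEN sets_eq_imp_space_eq] by simp
    then show ?thesis
      by (simp add: M.emeasure_eq_measure N.emeasure_eq_measure)
  qed simp
  show ?thesis
  proof (rule measure_eqI_generator_eq[where E = "Collect closed" and \<Omega> = UNIV and A = "\<lambda>_. UNIV"])
    have "sets (borel :: 'a measure) = sigma_sets UNIV (Collect closed)"
      by (subst borel_eq_closed) simp
    then show "sets M = sigma_sets UNIV (Collect closed)" "sets N = sigma_sets UNIV (Collect closed)"
      using sets by simp_all
  qed (auto simp: Int_stable_def closed)
qed

section \<open>Dirichlet integrals\<close>

text \<open>For \<open>s > 0\<close> this is \<open>s powr (p - 1)\<close> times a power series in
  \<open>z s^2\<close>. It will stand for one Dirichlet factor together with the exponential moment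
  of the displacement of that duration.\<close>

definition dirichlet_kernel :: "(real \<Rightarrow> nat \<Rightarrow> real) \<Rightarrow> real \<Rightarrow> real \<Rightarrow> real \<Rightarrow> ennreal" where
  "dirichlet_kernel w z p s = (\<Sum>k. ennreal (w p k * z ^ k * frac_kernel (p + real (2 * k)) s))"

lemma borel_measurable_dirichlet_kernel [measurable]:
  "dirichlet_kernel w z p \<in> borel_measurable borel"
  unfolding dirichlet_kernel_def[abs_def] by measurable

text \<open>Equivalently, the generating functions of the sequences \<open>w p\<close> multiply by
  adding their parameters.\<close>

definition convolution_coeffs :: "(real \<Rightarrow> nat \<Rightarrow> real) \<Rightarrow> bool" where
  "convolution_coeffs w \<longleftrightarrow> (\<forall>p>0. \<forall>k. 0 \<le> w p k)
     \<and> (\<forall>p>0. \<forall>q>0. \<forall>k. (\<Sum>i\<le>k. w p i * w q (k - i)) = w (p + q) k)"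

text \<open>Kernels of orders \<open>p + 2i\<close> and \<open>q + 2j\<close> convolve to an order
  that depends only on \<open>i + j\<close>. Along each diagonal what remains is the sum of products
  \<open>w p i * w q j\<close>, which closes up by assumption.\<close>

lemma dirichlet_kernel_convolution:
  assumes w: "convolution_coeffs w" and p: "p > 0" and q: "q > 0" and z: "z \<ge> 0"
  shows "(\<integral>\<^sup>+x. dirichlet_kernel w z p x * dirichlet_kernel w z q (t - x) \<partial>lborel)
           = dirichlet_kernel w z (p + q) t"
proof -
  have w0: "0 \<le> w p k" "0 \<le> w q k" for k using w p q by (auto simp: convolution_coeffs_def)
  have fk: "0 \<le> frac_kernel (p + real (2 * k)) s" "0 \<le> frac_kernel (q + real (2 * k)) s"
    "0 \<le> frac_kernel (p + q + real (2 * k)) s" for k s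
    using p q by (auto intro!: frac_kernel_nonneg add_pos_nonneg)
  let ?c = "\<lambda>i j. w p i * z ^ i * (w q j * z ^ j)"
  have c0: "0 \<le> ?c i j" for i j using w0 z by simp
  let ?e = "\<lambda>i j x. ennreal (?c i j) *
      (ennreal (frac_kernel (p + real (2 * i)) x) * ennreal (frac_kernel (q + real (2 * j)) (t - x)))"
  have "(\<integral>\<^sup>+x. dirichlet_kernel w z p x * dirichlet_kernel w z q (t - x) \<partial>lborel)
      = (\<integral>\<^sup>+x. (\<Sum>i. \<Sum>j. ?e i j x) \<partial>lborel)"
  proof (intro nn_integral_cong)
    fix x :: real
    have "dirichlet_kernel w z p x * dirichlet_kernel w z q (t - x)
      = (\<Sum>i. \<Sum>j. ennreal (w p i * z ^ i * frac_kernel (p + real (2 * i)) x)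
          * ennreal (w q j * z ^ j * frac_kernel (q + real (2 * j)) (t - x)))"
      by (simp only: dirichlet_kernel_def ennreal_suminf_cmult ennreal_suminf_multc)
    also have "\<dots> = (\<Sum>i. \<Sum>j. ?e i j x)"
    proof (intro suminf_cong)
      fix i j
      show "ennreal (w p i * z ^ i * frac_kernel (p + real (2 * i)) x)
          * ennreal (w q j * z ^ j * frac_kernel (q + real (2 * j)) (t - x)) = ?e i j x"
        using w0 z fk by (simp add: ennreal_mult del: of_nat_mult) (simp only: mult_ac)
    qed
    finally show "dirichlet_kernel w z p x * dirichlet_kernel w z q (t - x) = (\<Sum>i. \<Sum>j. ?e i j x)" .
  qed
  also have "\<dots> = (\<Sum>i. \<Sum>j. \<integral>\<^sup>+x. ?e i j x \<partial>lborel)"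
    by (subst nn_integral_suminf, measurable, subst nn_integral_suminf, measurable)
  also have "\<dots> = (\<Sum>i. \<Sum>j. ennreal (?c i j * frac_kernel (p + q + real (2 * (i + j))) t))"
  proof (intro suminf_cong)
    fix i j
    have "(\<integral>\<^sup>+x. ?e i j x \<partial>lborel)
        = ennreal (?c i j) * ennreal (frac_kernel (p + real (2 * i) + (q + real (2 * j))) t)"
      using p q by (subst nn_integral_cmult, measurable, subst frac_kernel_convolution) auto
    also have "p + real (2 * i) + (q + real (2 * j)) = p + q + real (2 * (i + j))" by simp
    finally show "(\<integral>\<^sup>+x. ?e i j x \<partial>lborel) = ennreal (?c i j * frac_kernel (p + q + real (2 * (i + j))) t)"
      using c0 by (simp add: ennreal_mult')
  qed
  also have "\<dots> = (\<Sum>k. \<Sum>i\<le>k. ennreal (?c i (k - i) * frac_kernel (p + q + real (2 * k)) t))"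
    by (subst suminf_ennreal_Cauchy_product) (intro suminf_cong sum.cong, auto)
  also have "\<dots> = dirichlet_kernel w z (p + q) t"
    unfolding dirichlet_kernel_def
  proof (intro suminf_cong)
    fix k
    have "(\<Sum>i\<le>k. ennreal (?c i (k - i) * frac_kernel (p + q + real (2 * k)) t))
        = ennreal (\<Sum>i\<le>k. ?c i (k - i) * frac_kernel (p + q + real (2 * k)) t)"
      by (intro sum_ennreal mult_nonneg_nonneg[OF c0 fk(3)])
    also have "(\<Sum>i\<le>k. ?c i (k - i) * frac_kernel (p + q + real (2 * k)) t)
        = (\<Sum>i\<le>k. (w p i * w q (k - i)) * (z ^ k * frac_kernel (p + q + real (2 * k)) t))"
    proof (intro sum.cong refl)
      fix i assume "i \<in> {..k}"
      then have "z ^ k = z ^ i * z ^ (k - i)" by (simp add: power_add[symmetric])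
      then show "?c i (k - i) * frac_kernel (p + q + real (2 * k)) t
          = (w p i * w q (k - i)) * (z ^ k * frac_kernel (p + q + real (2 * k)) t)"
        by (simp only: mult_ac)
    qed
    also have "\<dots> = w (p + q) k * z ^ k * frac_kernel (p + q + real (2 * k)) t"
      using w p q by (simp add: sum_distrib_right[symmetric] convolution_coeffs_def)
    finally show "(\<Sum>i\<le>k. ennreal (?c i (k - i) * frac_kernel (p + q + real (2 * k)) t))
        = ennreal (w (p + q) k * z ^ k * frac_kernel (p + q + real (2 * k)) t)" .
  qed
  finally show ?thesis .
qed

text \<open>An iterated convolution in which the last kernel takes the remaining time. Integrating
  out the last variable merges its kernel with the remainder and changes \<open>q\<close> to
  \<open>a + q\<close>. The simplex is implicit, since the kernels vanish at nonpositive
  arguments.\<close>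

lemma nn_integral_simplex_dirichlet_kernel:
  assumes w: "convolution_coeffs w" and a: "a > 0" and q: "q > 0" and z: "z \<ge> 0"
  shows "(\<integral>\<^sup>+s. (\<Prod>j=1..n. dirichlet_kernel w z a (s j))
             * dirichlet_kernel w z q (t - (\<Sum>j=1..n. s j)) \<partial>PiM {1..n} (\<lambda>_. lborel))
         = dirichlet_kernel w z (real n * a + q) t"
  using q
proof (induction n arbitrary: q)
  case 0
  then show ?case by (simp add: PiM_empty nn_integral_count_space_finite)
next
  case (Suc n)
  interpret product_sigma_finite "\<lambda>_. lborel :: real measure" by standard
  let ?K = "dirichlet_kernel w z"
  let ?F = "\<lambda>s. (\<Prod>j=1..Suc n. ?K a (s j)) * ?K q (t - (\<Sum>j=1..Suc n. s j))"
  have I: "{1..Suc n} = insert (Suc n) {1..n}" by auto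
  have meas: "?F \<in> borel_measurable (PiM (insert (Suc n) {1..n}) (\<lambda>_. lborel))"
    unfolding I[symmetric] by measurable
  have F: "?F (s(Suc n := y)) = (\<Prod>j=1..n. ?K a (s j)) *
      (?K a y * ?K q (t - (\<Sum>j=1..n. s j) - y))" for s y
  proof -
    have "(\<Prod>j=1..n. ?K a ((s(Suc n := y)) j)) = (\<Prod>j=1..n. ?K a (s j))"
      "(\<Sum>j=1..n. (s(Suc n := y)) j) = (\<Sum>j=1..n. s j)"
      by (auto intro!: prod.cong sum.cong)
    then show ?thesis by (simp add: diff_diff_eq mult_ac)
  qed
  have "(\<integral>\<^sup>+s. ?F s \<partial>PiM {1..Suc n} (\<lambda>_. lborel))
      = (\<integral>\<^sup>+s. (\<integral>\<^sup>+y. ?F (s(Suc n := y)) \<partial>lborel) \<partial>PiM {1..n} (\<lambda>_. lborel))"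
    unfolding I by (rule product_nn_integral_insert[OF _ _ meas[unfolded I]]) auto
  also have "\<dots> = (\<integral>\<^sup>+s. (\<Prod>j=1..n. ?K a (s j)) * ?K (a + q) (t - (\<Sum>j=1..n. s j)) \<partial>PiM {1..n} (\<lambda>_. lborel))"
    unfolding F by (intro nn_integral_cong, subst nn_integral_cmult, measurable,
        subst dirichlet_kernel_convolution[OF w a Suc.prems z]) simp
  also have "\<dots> = ?K (real n * a + (a + q)) t"
    using a Suc.prems by (intro Suc.IH) auto
  also have "real n * a + (a + q) = real (Suc n) * a + q" by (simp add: algebra_simps)
  finally show ?case .
qed

text \<open>The factor \<open>pochhammer p (2 * k)\<close> cancels the Gamma function in the kernel
  of order \<open>p + 2k\<close>, and \<open>pochhammer h k\<close> supplies the one of the Bessel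
  series of index \<open>h\<close>.\<close>

lemma dirichlet_kernel_eq_bessel_kernel:
  assumes w: "\<And>k. w p k = pochhammer p (2 * k) / (4 ^ k * fact k * pochhammer h k)"
    and p: "p > 0" and h: "h > 0" and z: "z \<ge> 0"
  shows "dirichlet_kernel w z p s
      = ennreal (frac_kernel p s) * (ennreal (Gamma h) * bessel_kernel h (z * s\<^sup>2) 1)"
proof (cases "s > 0")
  case False
  then show ?thesis by (simp add: dirichlet_kernel_def frac_kernel_def)
next
  case True
  have "w p k * z ^ k * frac_kernel (p + real (2 * k)) s
      = frac_kernel p s * (Gamma h * ((z * s\<^sup>2 / 4) ^ k / fact k * frac_kernel (h + real k) 1))" for k
  proof -
    have pos: "Gamma p > 0" "Gamma h > 0" "Gamma (p + real (2 * k)) > 0" "Gamma (h + real k) > 0"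
      using p h by (auto intro!: Gamma_real_pos add_pos_nonneg)
    have pk: "pochhammer p (2 * k) = Gamma (p + real (2 * k)) / Gamma p"
      "pochhammer h k = Gamma (h + real k) / Gamma h"
      using pochhammer_Gamma[OF pos_notin_nonpos_Ints] p h by auto
    have "s powr (p + real (2 * k) - 1) = s powr (p - 1) * (s\<^sup>2) ^ k"
      using True powr_add[of s "p - 1" "real (2 * k)"] powr_realpow[of s "2 * k"]
      by (simp add: power_mult[symmetric] algebra_simps)
    then show ?thesis
      unfolding w pk using True pos
      by (simp add: frac_kernel_def power_mult_distrib power_divide field_simps del: of_nat_mult)
  qed
  moreover have "0 \<le> frac_kernel p s" "0 \<le> Gamma h"
    using p h by (auto simp: frac_kernel_nonneg Gamma_real_pos less_imp_le)
  ultimately show ?thesis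
    unfolding dirichlet_kernel_def bessel_kernel_def
    by (simp only: ennreal_mult' ennreal_suminf_cmult)
qed

section \<open>Convolution identities for the coefficients\<close>

lemma pochhammer_Vandermonde:
  fixes p q :: real
  shows "(\<Sum>i\<le>k. pochhammer p i / fact i * (pochhammer q (k - i) / fact (k - i)))
       = pochhammer (p + q) k / fact k"
proof -
  have "pochhammer (p + q) k / fact k
      = (\<Sum>i\<le>k. of_nat (k choose i) * pochhammer p i * pochhammer q (k - i) / fact k)"
    by (simp add: pochhammer_binomial_sum sum_divide_distrib)
  also have "\<dots> = (\<Sum>i\<le>k. pochhammer p i / fact i * (pochhammer q (k - i) / fact (k - i)))"
    by (intro sum.cong) (auto simp: binomial_fact)
  finally show ?thesis ..
qed

text \<open>Duplication splits \<open>pochhammer p (2 * k)\<close> into its even and odd factors.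
  What survives is the coefficient sequence of \<open>(1 - X)^(-p/2)\<close>, whence the semigroup
  property in \<open>p\<close>.\<close>

lemma pochhammer_double_ratio:
  fixes p :: real
  assumes "p > 0"
  shows "pochhammer p (2 * k) / (4 ^ k * fact k * pochhammer ((p + 1) / 2) k) = pochhammer (p / 2) k / fact k"
proof -
  have "pochhammer ((p + 1) / 2) k > 0" using assms by (intro pochhammer_pos) auto
  moreover have "p / 2 + 1 / 2 = (p + 1) / 2" by simp
  ultimately show ?thesis
    using pochhammer_double[of "p / 2" k, unfolded \<open>p / 2 + 1 / 2 = (p + 1) / 2\<close>]
    by (simp add: power_mult)
qed

text \<open>The coefficients \<open>s p\<close> are those of \<open>B\<^sup>p = exp (p L)\<close>, where \<open>B\<close> is the generating function of
  the Catalan numbers. As \<open>X L' = E = ((1 - 4X)\<^bsup>-1/2\<^esup> - 1) / 2\<close>, this power series solves a second-order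
  equation for the Euler operator \<open>X d/dX\<close>, which is the recurrence satisfied by \<open>s p\<close>.\<close>

lemma pochhammer_Rothe_Hagen:
  fixes p q :: real
  assumes p: "p > 0" and q: "q > 0"
  defines "s \<equiv> \<lambda>p k. pochhammer p (2 * k) / (fact k * pochhammer (p + 1) k)"
  shows "(\<Sum>i\<le>k. s p i * s q (k - i)) = s (p + q) k"
proof -
  \<comment> \<open>\<open>G\<close> is the series of \<open>(1 - 4X)^(-1/2)\<close>, obtained by
    composing the binomial series with \<open>-4X\<close>.\<close>
  define G :: "real fps" where "G = fps_binomial (-1/2) oo (fps_const (-4) * fps_X)"
  have X0: "fps_nth (fps_const (-4) * fps_X :: real fps) 0 = 0" by simp
  have G2: "G * G * (1 - 4 * fps_X) = 1"
  proof -
    have "(1 - 4 * fps_X :: real fps) = (1 + fps_X) oo (fps_const (-4) * fps_X)"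
      by (simp add: fps_compose_add_distrib numeral_fps_const fps_eq_iff)
    then have "G * G * (1 - 4 * fps_X)
        = (fps_binomial (-1/2) * fps_binomial (-1/2) * (1 + fps_X)) oo (fps_const (-4) * fps_X)"
      unfolding G_def by (simp only: fps_compose_mult_distrib[OF X0])
    also have "fps_binomial (-1/2) * fps_binomial (-1/2) * (1 + fps_X) = (1 :: real fps)"
      by (simp add: fps_binomial_add_mult[symmetric] fps_binomial_minus_one inverse_mult_eq_1)
    finally show ?thesis by simp
  qed
  have G0: "fps_nth G 0 = 1" by (simp add: G_def)
  define E where "E = fps_const (1/2) * (G - 1)"
  have E0: "fps_nth E 0 = 0" by (simp add: E_def G0)
  have G: "G = 2 * E + 1"
    unfolding E_def by (simp add: numeral_fps_const mult.assoc[symmetric])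
  \<comment> \<open>As \<open>E\<close> has no constant term, \<open>D = E / X\<close> is again a
    power series. Its antiderivative \<open>L\<close> has constant term 0, so it may be substituted
    into the exponential series.\<close>
  define D where "D = fps_shift 1 E"
  have XD: "fps_X * D = E"
    unfolding D_def using E0 by (intro fps_ext) (auto simp: fps_X_mult_nth)
  define L where "L = fps_integral0 D"
  have L0: "fps_nth L 0 = 0" by (simp add: L_def)
  have dL: "fps_deriv L = D" by (simp add: L_def fps_deriv_fps_integral)
  \<comment> \<open>\<open>y p\<close> plays the part of the power \<open>B^p\<close>. The
    exponential law gives additivity in \<open>p\<close>, so only the coefficients remain to be
    identified.\<close>
  define y where "y p = (fps_exp p oo L)" for p
  have y_mult: "y p * y q = y (p + q)" for p q
    unfolding y_def by (simp add: fps_exp_add_mult fps_compose_mult_distrib[OF L0])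
  have theta_y: "fps_X * fps_deriv (y p) = fps_const p * E * y p" for p
  proof -
    have "fps_deriv (y p) = fps_const p * y p * D"
      unfolding y_def fps_compose_deriv[OF L0] dL fps_exp_deriv fps_const_mult_apply_left ..
    then show ?thesis unfolding XD[symmetric] by (simp only: mult_ac)
  qed
  \<comment> \<open>Obtained by differentiating \<open>G^2 (1 - 4X) = 1\<close> and cancelling one
    factor \<open>G\<close>.\<close>
  have theta_E: "(1 - 4 * fps_X) * (fps_X * fps_deriv E) = fps_X * (2 * E + 1)"
  proof -
    have "fps_deriv (G * G * (1 - 4 * fps_X)) = 0" unfolding G2 by simp
    then have "G * (4 * ((1 - 4 * fps_X) * fps_deriv E) - 4 * G) = 0"
      unfolding G by (simp add: algebra_simps)
    moreover have "G \<noteq> 0" using G0 by auto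
    ultimately have "4 * ((1 - 4 * fps_X) * fps_deriv E - G) = 0" by (simp add: right_diff_distrib)
    then have "(1 - 4 * fps_X) * fps_deriv E = G" by simp
    then show ?thesis unfolding G by algebra
  qed
  have quadr: "(1 - 4 * fps_X) * (E * E + E) = fps_X"
  proof -
    have "4 * ((1 - 4 * fps_X) * (E * E + E) - fps_X) = 0"
      using G2 unfolding G by algebra
    then show ?thesis by simp
  qed
  have nth: "fps_nth (y p) k = s p k" if p: "p > 0" for p k
  proof (induction k)
    case 0
    then show ?case by (simp add: y_def s_def)
  next
    case (Suc k)
    let ?y = "y p" and ?p = "fps_const p"
    let ?t = "fps_X * fps_deriv ?y"
    have tt: "fps_X * fps_deriv ?t = ?p * (fps_X * fps_deriv E) * ?y + ?p * E * ?t"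
    proof -
      have "fps_deriv ?t = fps_deriv (?p * E * ?y)" by (simp only: theta_y)
      also have "\<dots> = ?p * fps_deriv E * ?y + ?p * E * fps_deriv ?y"
        by (simp add: algebra_simps)
      finally show ?thesis by (simp only: distrib_left mult_ac)
    qed
    \<comment> \<open>With \<theta> denoting the Euler operator, this reads \<open>\<theta>
      (\<theta> + p) y = X (2\<theta> + p) (2\<theta> + p + 1) y\<close>. Since \<theta> multiplies
      the \<open>k\<close>-th coefficient by \<open>k\<close>, comparing coefficients gives a
      two-term recurrence.\<close>
    have "fps_X * fps_deriv ?t + ?p * ?t
        = fps_X * (4 * (fps_X * fps_deriv ?t) + 2 * (2 * ?p + 1) * ?t + ?p * (?p + 1) * ?y)"
      using theta_E quadr tt theta_y[of p] by algebra
    then have "fps_nth (fps_X * fps_deriv ?t + ?p * ?t) (Suc k)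
        = fps_nth (fps_X * (4 * (fps_X * fps_deriv ?t) + 2 * (2 * ?p + 1) * ?t + ?p * (?p + 1) * ?y)) (Suc k)"
      by simp
    then have rec: "real (Suc k) * (p + real (Suc k)) * fps_nth ?y (Suc k)
        = (p + 2 * real k) * (p + 2 * real k + 1) * fps_nth ?y k"
      by (cases k) (simp_all add: fps_X_mult_nth numeral_fps_const mult.assoc distrib_right
          fps_const_add[symmetric] del: fps_const_add, simp_all add: algebra_simps)
    have pos: "pochhammer (p + 1) k > 0" using p by (intro pochhammer_pos) auto
    have "real (Suc k) * (p + real (Suc k)) * s p (Suc k)
        = (p + 2 * real k) * (p + 2 * real k + 1) * s p k"
    proof -
      have "pochhammer p (2 * Suc k) = pochhammer p (2 * k) * (p + 2 * real k) * (p + 2 * real k + 1)"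
        by (simp add: pochhammer_Suc algebra_simps)
      moreover have "pochhammer (p + 1) (Suc k) = pochhammer (p + 1) k * (p + real (Suc k))"
        by (simp add: pochhammer_Suc algebra_simps)
      ultimately show ?thesis
        using pos p unfolding s_def by (simp add: divide_simps)
    qed
    with rec Suc.IH have "real (Suc k) * (p + real (Suc k)) * fps_nth ?y (Suc k)
        = real (Suc k) * (p + real (Suc k)) * s p (Suc k)" by simp
    then show ?case using p by simp
  qed
  have "(\<Sum>i\<le>k. s p i * s q (k - i)) = (\<Sum>i=0..k. fps_nth (y p) i * fps_nth (y q) (k - i))"
    using p q by (simp add: nth atMost_atLeast0)
  also have "\<dots> = fps_nth (y (p + q)) k"
    unfolding y_mult[symmetric] by (simp add: fps_mult_nth)
  also have "\<dots> = s (p + q) k" using p q by (simp add: nth)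
  finally show ?thesis .
qed

lemma convolution_coeffs_half:
  "convolution_coeffs (\<lambda>p k. pochhammer p (2 * k) / (4 ^ k * fact k * pochhammer ((p + 1) / 2) k))"
  unfolding convolution_coeffs_def
proof (intro conjI allI impI)
  fix p q :: real and k assume p: "p > 0" and q: "q > 0"
  show "(\<Sum>i\<le>k. pochhammer p (2 * i) / (4 ^ i * fact i * pochhammer ((p + 1) / 2) i) *
      (pochhammer q (2 * (k - i)) / (4 ^ (k - i) * fact (k - i) * pochhammer ((q + 1) / 2) (k - i))))
    = pochhammer (p + q) (2 * k) / (4 ^ k * fact k * pochhammer ((p + q + 1) / 2) k)"
    using p q pochhammer_Vandermonde[of "p / 2" "q / 2" k]
    by (simp add: pochhammer_double_ratio add_divide_distrib[symmetric])
qed (auto intro!: divide_nonneg_nonneg mult_nonneg_nonneg pochhammer_nonneg)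

lemma convolution_coeffs_plus_one:
  "convolution_coeffs (\<lambda>p k. pochhammer p (2 * k) / (4 ^ k * fact k * pochhammer (p + 1) k))"
  unfolding convolution_coeffs_def
proof (intro conjI allI impI)
  fix p q :: real and k assume p: "p > 0" and q: "q > 0"
  let ?s = "\<lambda>p k. pochhammer p (2 * k) / (fact k * pochhammer (p + 1) k)"
  have s: "pochhammer p (2 * k) / (4 ^ k * fact k * pochhammer (p + 1) k) = ?s p k / 4 ^ k" for p :: real and k
    by (simp add: mult_ac)
  have "(\<Sum>i\<le>k. ?s p i / 4 ^ i * (?s q (k - i) / 4 ^ (k - i))) = (\<Sum>i\<le>k. ?s p i * ?s q (k - i) / 4 ^ k)"
  proof (intro sum.cong refl)
    fix i assume "i \<in> {..k}"
    then have "(4 :: real) ^ k = 4 ^ i * 4 ^ (k - i)" by (simp add: power_add[symmetric])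
    then show "?s p i / 4 ^ i * (?s q (k - i) / 4 ^ (k - i)) = ?s p i * ?s q (k - i) / 4 ^ k" by simp
  qed
  also have "\<dots> = ?s (p + q) k / 4 ^ k"
    by (simp only: sum_divide_distrib[symmetric] pochhammer_Rothe_Hagen[OF p q])
  finally show "(\<Sum>i\<le>k. pochhammer p (2 * i) / (4 ^ i * fact i * pochhammer (p + 1) i) *
      (pochhammer q (2 * (k - i)) / (4 ^ (k - i) * fact (k - i) * pochhammer (q + 1) (k - i))))
    = pochhammer (p + q) (2 * k) / (4 ^ k * fact k * pochhammer (p + q + 1) k)"
    unfolding s .
qed (auto intro!: divide_nonneg_nonneg mult_nonneg_nonneg pochhammer_nonneg)

section \<open>The law of the position\<close>

text \<open>The case distinction in the density is absorbed by the kernels: outside the open simplex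
  some duration is nonpositive and its factor is 0.\<close>

lemma rescaled_dirichlet_density_eq_frac_kernel:
  assumes a: "a > 0"
  shows "rescaled_dirichlet_density a t n s
     = Gamma (real (n + 1) * a) / t powr (real (n + 1) * a - 1)
         * (\<Prod>j=1..n + 1. frac_kernel a (duration t n s j))"
proof (cases "(\<forall>j\<in>{1..n}. 0 < s j) \<and> (\<Sum>j=1..n. s j) < t")
  case True
  then have "0 < duration t n s j" if "j \<in> {1..n + 1}" for j
    using that by (auto simp: duration_def)
  then have "(\<Prod>j=1..n + 1. frac_kernel a (duration t n s j))
      = (\<Prod>j=1..n + 1. duration t n s j powr (a - 1) / Gamma a)"
    by (intro prod.cong) (auto simp: frac_kernel_def)
  also have "\<dots> = (\<Prod>j=1..n + 1. duration t n s j powr (a - 1)) / Gamma a ^ (n + 1)"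
    by (simp only: prod_dividef prod_constant card_atLeastAtMost) simp
  finally have "(\<Prod>j=1..n + 1. frac_kernel a (duration t n s j))
      = (\<Prod>j=1..n + 1. duration t n s j powr (a - 1)) / Gamma a ^ (n + 1)" .
  then show ?thesis
    unfolding rescaled_dirichlet_density_def using True by (simp only: if_True) simp
next
  case False
  then obtain j where "j \<in> {1..n + 1}" "duration t n s j \<le> 0"
  proof (cases "\<exists>j\<in>{1..n}. s j \<le> 0")
    case True
    then obtain j where "j \<in> {1..n}" "s j \<le> 0" by auto
    then show thesis by (intro that[of j]) (auto simp: duration_def)
  next
    case pos: False
    with False have "t \<le> (\<Sum>j=1..n. s j)" by (auto simp: not_le not_less)
    then show thesis by (intro that[of "n + 1"]) (auto simp: duration_def)
  qed
  then have "(\<Prod>j=1..n + 1. frac_kernel a (duration t n s j)) = 0"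
    by (intro prod_zero bexI[of _ j]) (auto simp: frac_kernel_def)
  then show ?thesis
    unfolding rescaled_dirichlet_density_def using False by (simp only: if_False)
qed

text \<open>Each factor of the density combines with its Bessel factor into a Dirichlet kernel of
  order \<open>a\<close>. Their iterated convolution has order \<open>(n + 1) * a\<close>; splitting
  it back leaves one Bessel factor and a power of \<open>t\<close> that the normalising constant
  cancels.\<close>

lemma nn_integral_rescaled_dirichlet_bessel_kernel:
  fixes h :: "real \<Rightarrow> real"
  assumes w: "convolution_coeffs (\<lambda>p k. pochhammer p (2 * k) / (4 ^ k * fact k * pochhammer (h p) k))"
    and a: "a > 0" and t: "t > 0" and z: "z \<ge> 0"
    and h: "h a > 0" "h (real (n + 1) * a) > 0"
  shows "(\<integral>\<^sup>+s. ennreal (rescaled_dirichlet_density a t n s) *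
            (\<Prod>j=1..n + 1. ennreal (Gamma (h a)) * bessel_kernel (h a) (z * (duration t n s j)\<^sup>2) 1)
          \<partial>PiM {1..n} (\<lambda>_. lborel))
       = ennreal (Gamma (h (real (n + 1) * a))) * bessel_kernel (h (real (n + 1) * a)) (z * t\<^sup>2) 1"
proof -
  define K where "K = dirichlet_kernel (\<lambda>p k. pochhammer p (2 * k) / (4 ^ k * fact k * pochhammer (h p) k)) z"
  have [measurable]: "K p \<in> borel_measurable borel" for p by (simp add: K_def)
  let ?p = "real (n + 1) * a"
  let ?C = "Gamma ?p / t powr (?p - 1)"
  have p: "?p > 0" using a by simp
  have C: "?C \<ge> 0" using Gamma_real_pos[OF p] by simp
  have K: "K p s = ennreal (frac_kernel p s) * (ennreal (Gamma (h p)) * bessel_kernel (h p) (z * s\<^sup>2) 1)"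
    if "p > 0" "h p > 0" for p s
    unfolding K_def by (rule dirichlet_kernel_eq_bessel_kernel) (simp_all add: that z)
  have "ennreal (rescaled_dirichlet_density a t n s) *
            (\<Prod>j=1..n + 1. ennreal (Gamma (h a)) * bessel_kernel (h a) (z * (duration t n s j)\<^sup>2) 1)
      = ennreal ?C * ((\<Prod>j=1..n. K a (s j)) * K a (t - (\<Sum>j=1..n. s j)))" for s
  proof -
    have "ennreal (rescaled_dirichlet_density a t n s)
        = ennreal ?C * (\<Prod>j=1..n + 1. ennreal (frac_kernel a (duration t n s j)))"
      unfolding rescaled_dirichlet_density_eq_frac_kernel[OF a]
      by (simp only: ennreal_mult'[OF C] prod_ennreal[OF frac_kernel_nonneg[OF a]])
    then have "ennreal (rescaled_dirichlet_density a t n s) *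
            (\<Prod>j=1..n + 1. ennreal (Gamma (h a)) * bessel_kernel (h a) (z * (duration t n s j)\<^sup>2) 1)
        = ennreal ?C * (\<Prod>j=1..n + 1. K a (duration t n s j))"
      by (simp only: K[OF a h(1)] prod.distrib mult.assoc)
    also have "(\<Prod>j=1..n + 1. K a (duration t n s j)) = (\<Prod>j=1..n. K a (s j)) * K a (t - (\<Sum>j=1..n. s j))"
    proof -
      have "(\<Prod>j=1..n. K a (duration t n s j)) = (\<Prod>j=1..n. K a (s j))"
        by (intro prod.cong) (auto simp: duration_def)
      then show ?thesis by (simp add: duration_def)
    qed
    finally show ?thesis .
  qed
  then have "(\<integral>\<^sup>+s. ennreal (rescaled_dirichlet_density a t n s) *
            (\<Prod>j=1..n + 1. ennreal (Gamma (h a)) * bessel_kernel (h a) (z * (duration t n s j)\<^sup>2) 1)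
          \<partial>PiM {1..n} (\<lambda>_. lborel))
      = (\<integral>\<^sup>+s. ennreal ?C * ((\<Prod>j=1..n. K a (s j)) * K a (t - (\<Sum>j=1..n. s j))) \<partial>PiM {1..n} (\<lambda>_. lborel))"
    by simp
  also have "\<dots> = ennreal ?C * K (real n * a + a) t"
    using nn_integral_simplex_dirichlet_kernel[OF w a a z, of n t, folded K_def]
    by (subst nn_integral_cmult) auto
  also have "real n * a + a = ?p" by (simp add: algebra_simps)
  also have "ennreal ?C * K ?p t = ennreal (?C * frac_kernel ?p t) *
      (ennreal (Gamma (h ?p)) * bessel_kernel (h ?p) (z * t\<^sup>2) 1)"
    unfolding K[OF p h(2)] ennreal_mult'[OF C] by (simp only: mult.assoc)
  also have "?C * frac_kernel ?p t = 1"
    using t Gamma_real_pos[OF p] by (auto simp: frac_kernel_def)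
  finally show ?thesis by simp
qed

text \<open>By independence the joint law of durations and directions is a product. For fixed
  durations the exponential factors over the directions, the \<open>j\<close>-th one being tested
  against \<alpha> scaled by \<open>c\<close> times its duration.\<close>

lemma (in random_flight) nn_integral_exp_flight_position:
  fixes \<alpha> :: "real ^ 'd"
  assumes d: "CARD('d) \<ge> 2"
    and T: "distributed M (PiM {1..n} (\<lambda>_. lborel)) (\<lambda>\<omega>. \<lambda>j\<in>{1..n}. \<tau> j \<omega>) f"
  shows "(\<integral>\<^sup>+\<omega>. ennreal (exp (\<alpha> \<bullet> flight_position c t n \<tau> V \<omega>)) \<partial>M)
       = (\<integral>\<^sup>+s. f s * (\<Prod>j=1..n + 1. ennreal (Gamma (real CARD('d) / 2)) *
            bessel_kernel (real CARD('d) / 2) ((c * norm \<alpha>)\<^sup>2 * (duration t n s j)\<^sup>2) 1) \<partial>PiM {1..n} (\<lambda>_. lborel))"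
proof -
  let ?T = "\<lambda>\<omega>. \<lambda>j\<in>{1..n}. \<tau> j \<omega>" and ?X = "\<lambda>\<omega>. \<lambda>j\<in>{1..n + 1}. V j \<omega>"
  let ?P = "PiM {1..n} (\<lambda>_. borel) :: (nat \<Rightarrow> real) measure"
  let ?Q = "PiM {1..n + 1} (\<lambda>_. borel) :: (nat \<Rightarrow> real ^ 'd) measure"
  let ?U = "uniform_sphere :: (real ^ 'd) measure"
  have sets_P: "sets (PiM {1..n} (\<lambda>_. lborel :: real measure)) = sets ?P"
    by (intro sets_PiM_cong) auto
  have mT: "?T \<in> measurable M ?P"
    using distributed_measurable[OF T] unfolding measurable_cong_sets[of M M, OF refl sets_P] .
  have mV: "V j \<in> borel_measurable M" if "j \<in> {1..n + 1}" for j
    using indep_directions that unfolding indep_vars_def by auto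
  have mX: "?X \<in> measurable M ?Q" by (intro measurable_restrict mV)
  let ?S = "distr M ?P ?T" and ?N = "distr M ?Q ?X"
  have prob: "prob_space ?S" "prob_space ?N" by (rule prob_space_distr, fact)+
  have "prob_space ?U"
    using uniform_directions[of 1] prob_space_distr[OF mV[of 1]] by simp
  then interpret U: product_sigma_finite "\<lambda>_ :: nat. ?U"
    by (simp add: product_sigma_finite_def prob_space_imp_sigma_finite)
  have [measurable_cong]: "sets ?U = sets borel" by (simp add: uniform_sphere_def)
  interpret S: prob_space ?S by fact
  interpret N: prob_space ?N by fact
  \<comment> \<open>Independence of the generated sigma-algebras gives the product rule on
    rectangles, which determines the joint law.\<close>
  have pair: "?S \<Otimes>\<^sub>M ?N = distr M (?P \<Otimes>\<^sub>M ?Q) (\<lambda>\<omega>. (?T \<omega>, ?X \<omega>))"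
  proof (rule pair_measure_eqI)
    fix A B assume A: "A \<in> sets ?S" and B: "B \<in> sets ?N"
    have "prob ((?T -` A \<inter> space M) \<inter> (?X -` B \<inter> space M)) = prob (?T -` A \<inter> space M) * prob (?X -` B \<inter> space M)"
      using A B by (intro indep_setD[OF indep_durations] in_vimage_algebra) auto
    moreover have "(\<lambda>\<omega>. (?T \<omega>, ?X \<omega>)) -` (A \<times> B) \<inter> space M = (?T -` A \<inter> space M) \<inter> (?X -` B \<inter> space M)"
      by auto
    ultimately show "emeasure ?S A * emeasure ?N B
        = emeasure (distr M (?P \<Otimes>\<^sub>M ?Q) (\<lambda>\<omega>. (?T \<omega>, ?X \<omega>))) (A \<times> B)"
      using A B mT mX by (simp add: emeasure_distr measurable_Pair emeasure_eq_measure ennreal_mult')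
  next
    show "sigma_finite_measure ?S" "sigma_finite_measure ?N"
      by (rule prob_space_imp_sigma_finite, fact)+
  qed simp
  have "?N = PiM {1..n + 1} (\<lambda>j. distr M borel (V j))"
    using indep_directions by (subst (asm) indep_vars_iff_distr_eq_PiM') (auto intro: mV)
  also have "\<dots> = PiM {1..n + 1} (\<lambda>_. ?U)"
    by (intro PiM_cong uniform_directions) auto
  finally have N: "?N = PiM {1..n + 1} (\<lambda>_. ?U)" .
  let ?g = "\<lambda>s v. \<Prod>j=1..n + 1. ennreal (exp (((c * duration t n s j) *\<^sub>R \<alpha>) \<bullet> v j))"
  let ?G = "\<lambda>s. \<Prod>j=1..n + 1. ennreal (Gamma (real CARD('d) / 2)) *
            bessel_kernel (real CARD('d) / 2) ((c * norm \<alpha>)\<^sup>2 * (duration t n s j)\<^sup>2) 1"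
  have dur: "(\<lambda>s. duration t n s j) \<in> borel_measurable ?P" if "j \<in> {1..n + 1}" for j
  proof (cases "j = n + 1")
    case True
    then show ?thesis unfolding duration_def by simp
  next
    case False
    with that have "j \<in> {1..n}" by auto
    with False show ?thesis unfolding duration_def by simp
  qed
  have mG: "?G \<in> borel_measurable ?P"
  proof (intro borel_measurable_prod_ennreal)
    fix j assume j: "j \<in> {1..n + 1}"
    note dur[OF j, measurable]
    show "(\<lambda>s. ennreal (Gamma (real CARD('d) / 2)) *
        bessel_kernel (real CARD('d) / 2) ((c * norm \<alpha>)\<^sup>2 * (duration t n s j)\<^sup>2) 1) \<in> borel_measurable ?P"
      by measurable
  qed
  have mg: "case_prod ?g \<in> borel_measurable (?P \<Otimes>\<^sub>M ?Q)"
    unfolding case_prod_beta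
  proof (intro borel_measurable_prod_ennreal)
    fix j assume j: "j \<in> {1..n + 1}"
    have [measurable]: "(\<lambda>x. duration t n (fst x) j) \<in> borel_measurable (?P \<Otimes>\<^sub>M ?Q)"
      by (rule measurable_compose[OF measurable_fst dur[OF j]])
    have [measurable]: "(\<lambda>x. snd x j) \<in> borel_measurable (?P \<Otimes>\<^sub>M ?Q)"
      by (rule measurable_compose[OF measurable_snd measurable_component_singleton[OF j]])
    show "(\<lambda>x. ennreal (exp (((c * duration t n (fst x) j) *\<^sub>R \<alpha>) \<bullet> snd x j))) \<in> borel_measurable (?P \<Otimes>\<^sub>M ?Q)"
      by measurable
  qed
  have "(\<integral>\<^sup>+\<omega>. ennreal (exp (\<alpha> \<bullet> flight_position c t n \<tau> V \<omega>)) \<partial>M) = (\<integral>\<^sup>+\<omega>. case_prod ?g (?T \<omega>, ?X \<omega>) \<partial>M)"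
  proof (intro nn_integral_cong)
    fix \<omega>
    have dur_T: "duration t n (?T \<omega>) j = duration t n (\<lambda>i. \<tau> i \<omega>) j" if "j \<in> {1..n + 1}" for j
      using that by (auto simp: duration_def)
    have "\<alpha> \<bullet> flight_position c t n \<tau> V \<omega>
        = (\<Sum>j=1..n + 1. ((c * duration t n (?T \<omega>) j) *\<^sub>R \<alpha>) \<bullet> ?X \<omega> j)"
      unfolding flight_position_def inner_scaleR_right inner_sum_right sum_distrib_left
    proof (intro sum.cong refl)
      fix j assume j: "j \<in> {1..n + 1}"
      show "c * (duration t n (\<lambda>i. \<tau> i \<omega>) j * (\<alpha> \<bullet> V j \<omega>))
          = ((c * duration t n (?T \<omega>) j) *\<^sub>R \<alpha>) \<bullet> ?X \<omega> j"
        unfolding dur_T[OF j] using j by simp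
    qed
    then show "ennreal (exp (\<alpha> \<bullet> flight_position c t n \<tau> V \<omega>)) = case_prod ?g (?T \<omega>, ?X \<omega>)"
      by (simp only: exp_sum[OF finite_atLeastAtMost] prod_ennreal[OF exp_ge_zero] case_prod_conv)
  qed
  also have "\<dots> = (\<integral>\<^sup>+x. case_prod ?g x \<partial>(?S \<Otimes>\<^sub>M ?N))"
    unfolding pair by (rule nn_integral_distr[OF measurable_Pair[OF mT mX], symmetric]) (use mg in simp)
  also have "\<dots> = (\<integral>\<^sup>+s. (\<integral>\<^sup>+v. ?g s v \<partial>?N) \<partial>?S)"
  proof -
    have "(borel_measurable (?S \<Otimes>\<^sub>M ?N) :: (_ \<Rightarrow> ennreal) set) = borel_measurable (?P \<Otimes>\<^sub>M ?Q)"
      by (intro measurable_cong_sets sets_pair_measure_cong) simp_all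
    with mg have "case_prod ?g \<in> borel_measurable (?S \<Otimes>\<^sub>M ?N)" by blast
    from N.nn_integral_fst[OF this] show ?thesis by (simp only: case_prod_conv)
  qed
  also have "\<dots> = (\<integral>\<^sup>+s. ?G s \<partial>?S)"
  proof (intro nn_integral_cong)
    fix s
    have "(\<integral>\<^sup>+v. ?g s v \<partial>?N) = (\<Prod>j=1..n + 1. \<integral>\<^sup>+v. ennreal (exp (((c * duration t n s j) *\<^sub>R \<alpha>) \<bullet> v)) \<partial>?U)"
      unfolding N by (rule U.product_nn_integral_prod) auto
    also have "\<dots> = ?G s"
      unfolding nn_integral_exp_uniform_sphere[OF d]
      by (simp add: power_mult_distrib mult_ac)
    finally show "(\<integral>\<^sup>+v. ?g s v \<partial>?N) = ?G s" .
  qed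
  also have "\<dots> = (\<integral>\<^sup>+\<omega>. ?G (?T \<omega>) \<partial>M)"
    by (rule nn_integral_distr[OF mT]) (use mG in simp)
  also have "\<dots> = (\<integral>\<^sup>+s. f s * ?G s \<partial>PiM {1..n} (\<lambda>_. lborel))"
    by (rule distributed_nn_integral[OF T, symmetric]) (use mG in \<open>simp only: measurable_cong_sets[OF sets_P refl]\<close>)
  finally show ?thesis .
qed

section \<open>Measurability and boundedness of the position\<close>

lemma (in random_flight) random_variable_flight_position:
  assumes T: "distributed M (PiM {1..n} (\<lambda>_. lborel)) (\<lambda>\<omega>. \<lambda>j\<in>{1..n}. \<tau> j \<omega>) f"
  shows "flight_position c t n \<tau> V \<in> borel_measurable M"
proof -
  have \<tau>: "\<tau> j \<in> borel_measurable M" if "j \<in> {1..n}" for j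
    using measurable_compose[OF distributed_measurable[OF T] measurable_component_singleton[OF that]] that
    by simp
  have V [measurable]: "V j \<in> borel_measurable M" if "j \<in> {1..n + 1}" for j
    using indep_directions that unfolding indep_vars_def by auto
  have [measurable]: "(\<lambda>\<omega>. duration t n (\<lambda>i. \<tau> i \<omega>) j) \<in> borel_measurable M" if "j \<in> {1..n + 1}" for j
  proof (cases "j = n + 1")
    case True
    then show ?thesis
      unfolding duration_def by (auto intro!: borel_measurable_diff borel_measurable_sum \<tau>)
  next
    case False
    with that have "j \<in> {1..n}" by auto
    with False show ?thesis unfolding duration_def by (simp add: \<tau>)
  qed
  show ?thesis
    unfolding flight_position_def[abs_def]
    by (intro borel_measurable_scaleR borel_measurable_const borel_measurable_sum V) measurable
qed

text \<open>Triangle inequality for unit directions and nonnegative durations of total length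
  \<open>t\<close>. It supplies the bounded support for the uniqueness argument.\<close>

lemma (in random_flight) AE_norm_flight_position_le:
  assumes d: "CARD('d) \<ge> 2" and c: "c \<ge> 0"
  shows "AE \<omega> in M. norm (flight_position c t n \<tau> V \<omega>) \<le> c * t"
proof -
  have V: "V j \<in> borel_measurable M" if "j \<in> {1..n + 1}" for j
    using indep_directions that unfolding indep_vars_def by auto
  have "AE \<omega> in M. norm (V j \<omega>) = 1" if j: "j \<in> {1..n + 1}" for j
  proof -
    have "AE v in distr M borel (V j). norm v = 1"
      unfolding uniform_directions[OF j] by (rule AE_uniform_sphere_norm[OF d])
    then show ?thesis by (subst (asm) AE_distr_iff) (auto intro: V[OF j])
  qed
  then have "AE \<omega> in M. \<forall>j\<in>{1..n + 1}. norm (V j \<omega>) = 1"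
    by (intro AE_finite_allI) auto
  with durations_simplex show ?thesis
  proof eventually_elim
    case (elim \<omega>)
    let ?d = "duration t n (\<lambda>i. \<tau> i \<omega>)"
    have pos: "0 \<le> ?d j" if "j \<in> {1..n + 1}" for j
      using elim that by (auto simp: duration_def less_imp_le)
    have "(\<Sum>j=1..n. ?d j) = (\<Sum>j=1..n. \<tau> j \<omega>)"
      by (intro sum.cong) (auto simp: duration_def)
    then have total: "(\<Sum>j=1..n + 1. ?d j) = t" by (simp add: duration_def)
    have "norm (\<Sum>j=1..n + 1. ?d j *\<^sub>R V j \<omega>) \<le> (\<Sum>j=1..n + 1. ?d j)"
      using elim pos by (intro order_trans[OF norm_sum] sum_mono) auto
    then show ?case
      unfolding total flight_position_def using c by (auto intro: mult_left_mono)
  qed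
qed

text \<open>Common form of both cases. The condition on \<open>h a\<close> makes the sphere moments
  fit the Dirichlet integral, and \<open>H\<close> exceeds \<open>d / 2\<close> so that the
  candidate kernel has positive order. Both laws have the Bessel series of index \<open>H\<close> as
  exponential moment.\<close>

lemma (in random_flight) distributed_flight_position:
  fixes h :: "real \<Rightarrow> real" and a c :: real
  defines "H \<equiv> h (real (n + 1) * a)"
  assumes w: "convolution_coeffs (\<lambda>p k. pochhammer p (2 * k) / (4 ^ k * fact k * pochhammer (h p) k))"
    and d: "CARD('d) \<ge> 2" and c: "c > 0" and t: "t > 0" and a: "a > 0"
    and h: "h a = real CARD('d) / 2" and b: "H > real CARD('d) / 2"
    and T: "distributed M (PiM {1..n} (\<lambda>_. lborel)) (\<lambda>\<omega>. \<lambda>j\<in>{1..n}. \<tau> j \<omega>)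
              (\<lambda>s. ennreal (rescaled_dirichlet_density a t n s))"
  shows "distributed M lborel (flight_position c t n \<tau> V)
     (\<lambda>x. ennreal (Gamma H / (pi powr (real CARD('d) / 2) * (c * t) powr (2 * H - 2))
        * frac_kernel (H - real CARD('d) / 2) ((c * t)\<^sup>2 - (norm x)\<^sup>2)))"
    (is "distributed _ _ _ (\<lambda>x. ennreal (?C * ?k x))")
proof -
  let ?X = "flight_position c t n \<tau> V"
  let ?M = "distr M lborel ?X" and ?N = "density lborel (\<lambda>x :: real ^ 'd. ennreal (?C * ?k x))"
  have ct: "c * t > 0" using c t by simp
  have H: "H > 0" using b by (rule le_less_trans[rotated]) simp
  have C: "?C \<ge> 0" using Gamma_real_pos[OF H] by simp
  have k: "?k x \<ge> 0" for x :: "real ^ 'd" using b by (intro frac_kernel_nonneg) simp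
  have [measurable]: "?X \<in> borel_measurable M" by (rule random_variable_flight_position[OF T])
  have [measurable]: "?k \<in> borel_measurable (borel :: (real ^ 'd) measure)" by measurable
  have mgf_M: "(\<integral>\<^sup>+x. ennreal (exp (\<alpha> \<bullet> x)) \<partial>?M)
      = ennreal (Gamma H) * bessel_kernel H ((c * norm \<alpha>)\<^sup>2 * t\<^sup>2) 1" for \<alpha> :: "real ^ 'd"
  proof -
    have "(\<integral>\<^sup>+x. ennreal (exp (\<alpha> \<bullet> x)) \<partial>?M) = (\<integral>\<^sup>+\<omega>. ennreal (exp (\<alpha> \<bullet> ?X \<omega>)) \<partial>M)"
      by (subst nn_integral_distr) auto
    also have "\<dots> = ennreal (Gamma H) * bessel_kernel H ((c * norm \<alpha>)\<^sup>2 * t\<^sup>2) 1"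
      unfolding nn_integral_exp_flight_position[OF d T] h[symmetric] H_def
      by (rule nn_integral_rescaled_dirichlet_bessel_kernel[OF w a t])
        (use h d H in \<open>auto simp: H_def\<close>)
    finally show ?thesis .
  qed
  have mgf_N: "(\<integral>\<^sup>+x. ennreal (exp (\<alpha> \<bullet> x)) \<partial>?N)
      = ennreal (Gamma H) * bessel_kernel H ((c * norm \<alpha>)\<^sup>2 * t\<^sup>2) 1" for \<alpha> :: "real ^ 'd"
  proof -
    have "(\<integral>\<^sup>+x. ennreal (exp (\<alpha> \<bullet> x)) \<partial>?N)
        = (\<integral>\<^sup>+x. ennreal ?C * (ennreal (exp (\<alpha> \<bullet> x)) * ennreal (?k x)) \<partial>lborel)"
    proof -
      have "(\<integral>\<^sup>+x. ennreal (exp (\<alpha> \<bullet> x)) \<partial>?N)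
          = (\<integral>\<^sup>+x. ennreal (?C * ?k x) * ennreal (exp (\<alpha> \<bullet> x)) \<partial>lborel)"
        by (subst nn_integral_density) auto
      then show ?thesis unfolding ennreal_mult'[OF C] by (simp only: mult_ac)
    qed
    also have "\<dots> = ennreal ?C * (ennreal (pi powr (real CARD('d) / 2)) * bessel_kernel H ((norm \<alpha>)\<^sup>2) ((c * t)\<^sup>2))"
      using b by (subst nn_integral_cmult, measurable, subst nn_integral_lborel_exp_frac_kernel) auto
    also have "bessel_kernel H ((norm \<alpha>)\<^sup>2) ((c * t)\<^sup>2)
        = ennreal (((c * t)\<^sup>2) powr (H - 1)) * bessel_kernel H ((c * t)\<^sup>2 * (norm \<alpha>)\<^sup>2) 1"
      using bessel_kernel_scale[of "(c * t)\<^sup>2" H "(norm \<alpha>)\<^sup>2" 1,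
          OF zero_less_power[OF ct] H zero_le_power2] by simp
    also have "(c * t)\<^sup>2 * (norm \<alpha>)\<^sup>2 = (c * norm \<alpha>)\<^sup>2 * t\<^sup>2"
      by (simp add: power_mult_distrib mult_ac)
    also have "((c * t)\<^sup>2) powr (H - 1) = (c * t) powr (2 * H - 2)"
    proof -
      have "((c * t)\<^sup>2) powr (H - 1) = ((c * t) powr 2) powr (H - 1)"
        using ct by simp
      then show ?thesis by (simp only: powr_powr) (simp add: algebra_simps)
    qed
    also have "ennreal ?C * (ennreal (pi powr (real CARD('d) / 2)) *
          (ennreal ((c * t) powr (2 * H - 2)) * bessel_kernel H ((c * norm \<alpha>)\<^sup>2 * t\<^sup>2) 1))
        = ennreal (?C * (pi powr (real CARD('d) / 2) * (c * t) powr (2 * H - 2)))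
            * bessel_kernel H ((c * norm \<alpha>)\<^sup>2 * t\<^sup>2) 1"
      unfolding ennreal_mult'[OF C] ennreal_mult'[OF powr_ge_zero] by (simp only: mult.assoc)
    also have "?C * (pi powr (real CARD('d) / 2) * (c * t) powr (2 * H - 2)) = Gamma H"
      using c t by simp
    finally show ?thesis .
  qed
  have "?M = ?N"
  proof (rule measure_eqI_exponential_moments)
    show "(\<integral>\<^sup>+x. ennreal (exp (\<alpha> \<bullet> x)) \<partial>?M) = (\<integral>\<^sup>+x. ennreal (exp (\<alpha> \<bullet> x)) \<partial>?N)" for \<alpha>
      unfolding mgf_M mgf_N ..
    \<comment> \<open>At \<alpha> = 0 the moments are the total masses, so the candidate density has
      finite mass without a separate integration.\<close>
    from this[of 0] have "emeasure ?N (space ?N) = emeasure ?M (space ?M)" by simp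
    moreover show M: "finite_measure ?M"
      by (intro prob_space.finite_measure prob_space_distr) simp
    ultimately show "finite_measure ?N"
      using finite_measure.emeasure_finite[OF M, of "space ?M"] by (intro finite_measureI) simp
    show "AE x in ?M. norm x \<le> c * t"
      using AE_norm_flight_position_le[OF d less_imp_le[OF c]] by (subst AE_distr_iff) auto
    have "norm x \<le> c * t" if "0 < ?C * ?k x" for x :: "real ^ 'd"
    proof -
      have "(norm x)\<^sup>2 < (c * t)\<^sup>2" using that by (auto simp: frac_kernel_def split: if_splits)
      then show ?thesis using ct by (intro less_imp_le power_less_imp_less_base[of "norm x" 2]) auto
    qed
    then show "AE x in ?N. norm x \<le> c * t"
      by (subst AE_density) (auto intro!: AE_I2)
  qed simp_all
  then show ?thesis
    unfolding distributed_def by (intro conjI) measurable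
qed

section \<open>The two explicit densities\<close>

lemma frac_kernel_diff_norm_squared:
  assumes "r > 0"
  shows "frac_kernel b (r\<^sup>2 - (norm x)\<^sup>2) = (if norm x < r then (r\<^sup>2 - (norm x)\<^sup>2) powr (b - 1) / Gamma b else 0)"
proof -
  have "0 < r\<^sup>2 - (norm x)\<^sup>2 \<longleftrightarrow> norm x < r"
    using assms power_less_imp_less_base[of "norm x" 2 r] power_strict_mono[of "norm x" r 2] by auto
  then show ?thesis by (simp only: frac_kernel_def)
qed

theorem theorem2:
  fixes c t :: real and n :: nat
    and M :: "'w measure" and \<tau> :: "nat \<Rightarrow> 'w \<Rightarrow> real" and V :: "nat \<Rightarrow> 'w \<Rightarrow> real ^ 'd"
  assumes "c > 0" and "t > 0" and "n \<ge> 1"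
    and "random_flight M t n \<tau> V"
  shows
    "(CARD('d) \<ge> 2 \<longrightarrow>
      distributed M (PiM {1..n} (\<lambda>_. lborel)) (\<lambda>\<omega>. \<lambda>j\<in>{1..n}. \<tau> j \<omega>)
        (\<lambda>s. ennreal (rescaled_dirichlet_density (real CARD('d) - 1) t n s)) \<longrightarrow>
      distributed M lborel (flight_position c t n \<tau> V)
        (\<lambda>x. ennreal (if norm x < c * t
           then Gamma (real (n + 1) / 2 * (real CARD('d) - 1) + 1 / 2)
                  / Gamma (real n / 2 * (real CARD('d) - 1))
                * ((c\<^sup>2 * t\<^sup>2 - (norm x)\<^sup>2) powr (real n / 2 * (real CARD('d) - 1) - 1)
                  / (pi powr (real CARD('d) / 2)
                     * (c * t) powr (real (n + 1) * (real CARD('d) - 1) - 1)))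
           else 0)))
     \<and>
     (CARD('d) \<ge> 3 \<longrightarrow>
      distributed M (PiM {1..n} (\<lambda>_. lborel)) (\<lambda>\<omega>. \<lambda>j\<in>{1..n}. \<tau> j \<omega>)
        (\<lambda>s. ennreal (rescaled_dirichlet_density (real CARD('d) / 2 - 1) t n s)) \<longrightarrow>
      distributed M lborel (flight_position c t n \<tau> V)
        (\<lambda>y. ennreal (if norm y < c * t
           then Gamma (real (n + 1) * (real CARD('d) / 2 - 1) + 1)
                  / Gamma (real n * (real CARD('d) / 2 - 1))
                * ((c\<^sup>2 * t\<^sup>2 - (norm y)\<^sup>2) powr (real n * (real CARD('d) / 2 - 1) - 1)
                  / (pi powr (real CARD('d) / 2)
                     * (c * t) powr (2 * real (n + 1) * (real CARD('d) / 2 - 1))))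
           else 0)))"
proof (intro conjI impI)
  interpret random_flight M t n \<tau> V by fact
  have ct: "c * t > 0" using assms by simp
  {
    assume d: "CARD('d) \<ge> 2" and T: "distributed M (PiM {1..n} (\<lambda>_. lborel)) (\<lambda>\<omega>. \<lambda>j\<in>{1..n}. \<tau> j \<omega>)
        (\<lambda>s. ennreal (rescaled_dirichlet_density (real CARD('d) - 1) t n s))"
    let ?a = "real CARD('d) - 1"
    \<comment> \<open>Here \<open>h p = (p + 1) / 2\<close>, with \<open>h ?a = d / 2\<close> at
      \<open>?a = d - 1\<close>. At \<open>(n + 1) * ?a\<close> it equals \<open>?H\<close>, which
      exceeds \<open>d / 2\<close> by \<open>n / 2 * ?a\<close>, the order of the kernel in the
      density.\<close>
    let ?H = "(real (n + 1) * ?a + 1) / 2"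
    have H: "?H = real n / 2 * ?a + real CARD('d) / 2" by (simp add: field_simps)
    have pos: "real n / 2 * ?a > 0" using d assms by simp
    show "distributed M lborel (flight_position c t n \<tau> V)
        (\<lambda>x. ennreal (if norm x < c * t
           then Gamma (real (n + 1) / 2 * (real CARD('d) - 1) + 1 / 2)
                  / Gamma (real n / 2 * (real CARD('d) - 1))
                * ((c\<^sup>2 * t\<^sup>2 - (norm x)\<^sup>2) powr (real n / 2 * (real CARD('d) - 1) - 1)
                  / (pi powr (real CARD('d) / 2)
                     * (c * t) powr (real (n + 1) * (real CARD('d) - 1) - 1)))
           else 0))"
    proof -
      have e: "?H - real CARD('d) / 2 = real n / 2 * ?a" "2 * ?H - 2 = real (n + 1) * ?a - 1"
        and e': "?H = real (n + 1) / 2 * ?a + 1 / 2"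
        unfolding H by (simp_all add: field_simps)
      have "distributed M lborel (flight_position c t n \<tau> V)
         (\<lambda>x. ennreal (Gamma ?H / (pi powr (real CARD('d) / 2) * (c * t) powr (2 * ?H - 2))
            * frac_kernel (?H - real CARD('d) / 2) ((c * t)\<^sup>2 - (norm x)\<^sup>2)))"
        using d assms pos H by (intro distributed_flight_position[OF convolution_coeffs_half _ _ _ _ _ _ T]) auto
      then show ?thesis
        unfolding e frac_kernel_diff_norm_squared[OF ct] unfolding e'
        by (rule arg_cong[where f = "distributed M lborel (flight_position c t n \<tau> V)", THEN iffD1, rotated])
          (auto simp: fun_eq_iff power_mult_distrib)
    qed
  }
  {
    assume d: "CARD('d) \<ge> 3" and T: "distributed M (PiM {1..n} (\<lambda>_. lborel)) (\<lambda>\<omega>. \<lambda>j\<in>{1..n}. \<tau> j \<omega>)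
        (\<lambda>s. ennreal (rescaled_dirichlet_density (real CARD('d) / 2 - 1) t n s))"
    let ?a = "real CARD('d) / 2 - 1"
    \<comment> \<open>Here \<open>h p = p + 1\<close>, again with \<open>h ?a = d / 2\<close>. The
      excess of \<open>?H\<close> over \<open>d / 2\<close> is now \<open>n * ?a\<close>, positive
      because \<open>d \<ge> 3\<close>.\<close>
    let ?H = "real (n + 1) * ?a + 1"
    have H: "?H = real n * ?a + real CARD('d) / 2" by (simp add: field_simps)
    have pos: "real n * ?a > 0" using d assms by simp
    show "distributed M lborel (flight_position c t n \<tau> V)
        (\<lambda>y. ennreal (if norm y < c * t
           then Gamma (real (n + 1) * (real CARD('d) / 2 - 1) + 1)
                  / Gamma (real n * (real CARD('d) / 2 - 1))
                * ((c\<^sup>2 * t\<^sup>2 - (norm y)\<^sup>2) powr (real n * (real CARD('d) / 2 - 1) - 1)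
                  / (pi powr (real CARD('d) / 2)
                     * (c * t) powr (2 * real (n + 1) * (real CARD('d) / 2 - 1))))
           else 0))"
    proof -
      have e: "?H - real CARD('d) / 2 = real n * ?a" "2 * ?H - 2 = 2 * real (n + 1) * ?a"
        unfolding H by (simp_all add: field_simps)
      have "distributed M lborel (flight_position c t n \<tau> V)
         (\<lambda>x. ennreal (Gamma ?H / (pi powr (real CARD('d) / 2) * (c * t) powr (2 * ?H - 2))
            * frac_kernel (?H - real CARD('d) / 2) ((c * t)\<^sup>2 - (norm x)\<^sup>2)))"
        using d assms pos H by (intro distributed_flight_position[OF convolution_coeffs_plus_one _ _ _ _ _ _ T]) auto
      then show ?thesis
        unfolding e frac_kernel_diff_norm_squared[OF ct]
        by (rule arg_cong[where f = "distributed M lborel (flight_position c t n \<tau> V)", THEN iffD1, rotated])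
          (auto simp: fun_eq_iff power_mult_distrib)
    qed
  }
qed

end
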